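(* Let $\lambda\vdash n$. As a polynomial in $q$, $$\deg F_\lambda(q)=\binom{n}{2}-n_\lambda,\qquad n_\lambda=\sum_{i\ge1}(i-1)\lambda_i.$$ Moreover, the coefficient of the highest degree term in $F_\lambda(q)$ is $f^\lambda$, the number of standard Young tableaux of shape $\lambda$.
   Context: For a prime power $q$, $F_\lambda(q)$ is the number of $n\times n$ upper-triangular nilpotent (i.e. strictly upper-triangular) matrices over $\mathbb{F}_q$ of Jordan type $\lambda$, meaning similar to $J_{\lambda_1}\oplus\cdots\oplus J_{\lambda_r}$, where $\lambda=(\lambda_1\ge\cdots\ge\lambda_r>0)$ and $J_i$ is the $i\times i$ Jordan block with eigenvalue $0$. For each fixed $\lambda$, this count is given for all prime powers $q$ by a (necessarily unique) polynomial in $q$ with integer coefficients, also denoted $F_\lambda(q)$; the claim concerns this polynomial. *)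

theory Defs
  imports "HOL-Algebra.Ring" "HOL-Computational_Algebra.Polynomial" "Jordan_Normal_Form.Matrix"
begin

section \<open>Partitions and standard Young tableaux\<close>

definition partition_of :: "nat list \<Rightarrow> nat \<Rightarrow> bool" where
  "partition_of la n \<longleftrightarrow> sorted_wrt (\<ge>) la \<and> (\<forall>k \<in> set la. 0 < k) \<and> sum_list la = n"

text \<open>Lists are indexed from \<open>0\<close>, so the factor \<open>i - 1\<close> of the usual formula becomes \<open>i\<close>.\<close>

definition partition_n :: "nat list \<Rightarrow> nat" where
  "partition_n la = (\<Sum>i < length la. i * la ! i)"

definition young_diagram :: "nat list \<Rightarrow> (nat \<times> nat) set" where
  "young_diagram la = {(i, j). i < length la \<and> j < la ! i}"

text \<open>Fillings are extensional functions on the diagram, so that they can be counted.\<close>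

definition standard_tableaux :: "nat list \<Rightarrow> (nat \<times> nat \<Rightarrow> nat) set" where
  "standard_tableaux la = {T \<in> extensional (young_diagram la).
     bij_betw T (young_diagram la) {1..sum_list la} \<and>
     (\<forall>i j j'. (i, j) \<in> young_diagram la \<longrightarrow> (i, j') \<in> young_diagram la \<longrightarrow> j < j'
        \<longrightarrow> T (i, j) < T (i, j')) \<and>
     (\<forall>i i' j. (i, j) \<in> young_diagram la \<longrightarrow> (i', j) \<in> young_diagram la \<longrightarrow> i < i'
        \<longrightarrow> T (i, j) < T (i', j))}"

section \<open>Matrices over a ring given as a record\<close>

text \<open>The counting polynomial depends on all finite fields at once, so the field must be an
  object of the logic (a record) and not a type of class \<open>field\<close>. The matrix type is used only
  as a container here; the arithmetic of its entries is that of the record \<open>K\<close>, and must not be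
  confused with the type class operations on the type of the entries.\<close>

definition sq_mats :: "('a, 'b) ring_scheme \<Rightarrow> nat \<Rightarrow> 'a mat set" where
  "sq_mats K n = {A \<in> carrier_mat n n. \<forall>i < n. \<forall>j < n. A $$ (i, j) \<in> carrier K}"

definition zero_mat_over :: "('a, 'b) ring_scheme \<Rightarrow> nat \<Rightarrow> nat \<Rightarrow> 'a mat" where
  "zero_mat_over K m n = mat m n (\<lambda>_. \<zero>\<^bsub>K\<^esub>)"

definition one_mat_over :: "('a, 'b) ring_scheme \<Rightarrow> nat \<Rightarrow> 'a mat" where
  "one_mat_over K n = mat n n (\<lambda>(i, j). if i = j then \<one>\<^bsub>K\<^esub> else \<zero>\<^bsub>K\<^esub>)"

definition mult_mat_over :: "('a, 'b) ring_scheme \<Rightarrow> 'a mat \<Rightarrow> 'a mat \<Rightarrow> 'a mat" where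
  "mult_mat_over K A B = mat (dim_row A) (dim_col B)
     (\<lambda>(i, j). \<Oplus>\<^bsub>K\<^esub>k\<in>{..<dim_col A}. A $$ (i, k) \<otimes>\<^bsub>K\<^esub> B $$ (k, j))"

definition similar_over :: "('a, 'b) ring_scheme \<Rightarrow> nat \<Rightarrow> 'a mat \<Rightarrow> 'a mat \<Rightarrow> bool" where
  "similar_over K n A B \<longleftrightarrow> A \<in> sq_mats K n \<and> B \<in> sq_mats K n \<and>
     (\<exists>P \<in> sq_mats K n. \<exists>Q \<in> sq_mats K n.
        mult_mat_over K P Q = one_mat_over K n \<and>
        mult_mat_over K Q P = one_mat_over K n \<and>
        A = mult_mat_over K (mult_mat_over K P B) Q)"

definition strictly_upper_mats :: "('a, 'b) ring_scheme \<Rightarrow> nat \<Rightarrow> 'a mat set" where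
  "strictly_upper_mats K n = {A \<in> sq_mats K n. \<forall>i < n. \<forall>j \<le> i. A $$ (i, j) = \<zero>\<^bsub>K\<^esub>}"

definition nilpotent_block :: "('a, 'b) ring_scheme \<Rightarrow> nat \<Rightarrow> 'a mat" where
  "nilpotent_block K k = mat k k (\<lambda>(i, j). if j = Suc i then \<one>\<^bsub>K\<^esub> else \<zero>\<^bsub>K\<^esub>)"

fun nilpotent_jordan_mat :: "('a, 'b) ring_scheme \<Rightarrow> nat list \<Rightarrow> 'a mat" where
  "nilpotent_jordan_mat K [] = zero_mat_over K 0 0"
| "nilpotent_jordan_mat K (k # ks) =
     four_block_mat (nilpotent_block K k) (zero_mat_over K k (sum_list ks))
       (zero_mat_over K (sum_list ks) k) (nilpotent_jordan_mat K ks)"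

definition jordan_type_count :: "('a, 'b) ring_scheme \<Rightarrow> nat list \<Rightarrow> nat" where
  "jordan_type_count K la = card {A \<in> strictly_upper_mats K (sum_list la).
     similar_over K (sum_list la) A (nilpotent_jordan_mat K la)}"

section \<open>The counting polynomial\<close>

text \<open>Every finite field has an isomorphic copy whose carrier is a set of integers, so
  quantifying over records on \<open>int\<close> covers all finite fields, hence all prime powers.\<close>

definition jordan_type_poly :: "nat list \<Rightarrow> int poly" where
  "jordan_type_poly la = (THE F. \<forall>K :: int ring. field K \<longrightarrow> finite (carrier K) \<longrightarrow>
     poly F (int (card (carrier K))) = int (jordan_type_count K la))"

end

theory Submission
  imports Defs "HOL-Number_Theory.Residues" "HOL-Combinatorics.Transposition"
begin

text \<open>
  A strictly upper triangular matrix of size \<open>n + 1\<close> is a strictly upper triangular matrix \<open>B\<close> of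
  size \<open>n\<close> bordered by a column \<open>v\<close>. If \<open>B\<close> has Jordan type \<open>\<mu>\<close>, the bordered matrix has type
  \<open>\<mu>\<close> plus one box, and the box lands in column \<open>k\<close> exactly if \<open>v\<close> lies in
  \<open>im B + ker B\<^sup>k\<^sup>-\<^sup>1\<close> but not in \<open>im B + ker B\<^sup>k\<^sup>-\<^sup>2\<close> (no second condition for \<open>k = 1\<close>).
  Since \<open>im B + ker B\<^sup>k\<^sup>-\<^sup>1\<close> has codimension \<open>\<mu>'\<^sub>k\<close>, this gives the recurrence (Borodin)
  \<open>F\<^sub>\<lambda> = \<Sum> c\<^sub>\<lambda>\<^sub>\<mu> F\<^sub>\<mu>\<close> over the partitions \<open>\<mu>\<close> obtained by removing a corner \<open>(r, k - 1)\<close> of \<open>\<lambda>\<close>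
  (indexed from \<open>0\<close>, so that \<open>r = \<mu>'\<^sub>k\<close>), where \<open>c\<^sub>\<lambda>\<^sub>\<mu>\<close> is monic of degree \<open>n - r\<close>. By
  induction every summand has degree \<open>(n + 1 choose 2) - n\<^sub>\<lambda>\<close>, so the leading coefficients add up
  according to the branching rule of standard Young tableaux.
\<close>

section \<open>Partitions, tableaux and the recursive polynomial\<close>

text \<open>A shape is a total function of row lengths, with zero for absent rows, so that adding or
  removing a box is a function update. Antimonotonicity is a separate condition, since some shapes
  below have their rows in arbitrary order.\<close>

definition cells :: "(nat \<Rightarrow> nat) \<Rightarrow> (nat \<times> nat) set" where
  "cells l = {(i, j). j < l i}"

definition is_partition :: "nat \<Rightarrow> (nat \<Rightarrow> nat) \<Rightarrow> bool" where
  "is_partition n l \<longleftrightarrow> antimono l \<and> finite (cells l) \<and> card (cells l) = n"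

text \<open>Only the row is recorded: the removable box is the last one of row \<open>r\<close>,
  namely \<open>(r, l r - 1)\<close>.\<close>

definition corner :: "(nat \<Rightarrow> nat) \<Rightarrow> nat \<Rightarrow> bool" where
  "corner l r \<longleftrightarrow> l (Suc r) < l r"

abbreviation remove_box :: "(nat \<Rightarrow> nat) \<Rightarrow> nat \<Rightarrow> nat \<Rightarrow> nat" where
  "remove_box l r \<equiv> l(r := l r - 1)"

text \<open>This is \<open>n_\<lambda>\<close> counted box by box, so that removing a box from row
  \<open>r\<close> lowers it by \<open>r\<close>.\<close>

definition row_weight :: "(nat \<Rightarrow> nat) \<Rightarrow> nat" where
  "row_weight l = (\<Sum>(i, j)\<in>cells l. i)"

definition syt :: "(nat \<Rightarrow> nat) \<Rightarrow> (nat \<times> nat \<Rightarrow> nat) set" where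
  "syt l = {T \<in> extensional (cells l).
     bij_betw T (cells l) {1..card (cells l)} \<and>
     (\<forall>i j j'. (i, j) \<in> cells l \<longrightarrow> (i, j') \<in> cells l \<longrightarrow> j < j' \<longrightarrow> T (i, j) < T (i, j')) \<and>
     (\<forall>i i' j. (i, j) \<in> cells l \<longrightarrow> (i', j) \<in> cells l \<longrightarrow> i < i' \<longrightarrow> T (i, j) < T (i', j))}"

text \<open>
  As a polynomial in \<open>q\<close>, the number of columns that extend a matrix of type \<open>remove_box l r\<close> and
  size \<open>n\<close> to one of type \<open>l\<close>. The truncated subtractions are exact for a corner \<open>r\<close> of a
  partition \<open>l\<close> of \<open>n + 1\<close>.
\<close>

definition box_poly :: "nat \<Rightarrow> (nat \<Rightarrow> nat) \<Rightarrow> nat \<Rightarrow> int poly" where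
  "box_poly n l r = Polynomial.monom 1 (n - r) -
     (if l r = 1 then 0 else Polynomial.monom 1 (n - card {i. l r - 1 \<le> remove_box l r i}))"

primrec jpoly :: "nat \<Rightarrow> (nat \<Rightarrow> nat) \<Rightarrow> int poly" where
  "jpoly 0 l = 1"
| "jpoly (Suc n) l = (\<Sum>r | corner l r. box_poly n l r * jpoly n (remove_box l r))"

lemma mem_cells [simp]: "(i, j) \<in> cells l \<longleftrightarrow> j < l i"
  by (simp add: cells_def)

lemma corner_pos: "corner l r \<Longrightarrow> 0 < l r"
  by (simp add: corner_def)

lemma cells_remove_box:
  assumes "0 < l r"
  shows "cells l = insert (r, l r - 1) (cells (remove_box l r))"
    and "(r, l r - 1) \<notin> cells (remove_box l r)"
  using assms by (auto simp: cells_def split: if_splits)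

lemma is_partition_remove_box:
  assumes "is_partition (Suc n) l" "corner l r"
  shows "is_partition n (remove_box l r)"
proof -
  have l: "antimono l" "finite (cells l)" "card (cells l) = Suc n"
    using assms(1) by (auto simp: is_partition_def)
  have pos: "0 < l r" using assms(2) by (rule corner_pos)
  have "antimono (remove_box l r)"
  proof (rule antimonoI)
    fix x y :: nat assume "x \<le> y"
    then have "l y \<le> l x" using l(1) by (simp add: antimonoD)
    moreover have "l y \<le> l r - 1" if "x = r" "y \<noteq> r"
    proof -
      have "Suc r \<le> y" using that \<open>x \<le> y\<close> by simp
      then have "l y \<le> l (Suc r)" using l(1) by (simp add: antimonoD)
      then show ?thesis using assms(2) by (simp add: corner_def)
    qed
    ultimately show "remove_box l r y \<le> remove_box l r x" by auto
  qed
  moreover have "finite (cells (remove_box l r))"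
    using l(2) cells_remove_box(1)[of l r, OF pos] by (metis finite_insert)
  moreover have "card (cells (remove_box l r)) = n"
    using l(3) cells_remove_box[of l r, OF pos] calculation(2) by (metis card_insert_disjoint Suc_inject)
  ultimately show ?thesis by (simp add: is_partition_def)
qed

lemma row_weight_remove_box:
  assumes "is_partition n l" "corner l r"
  shows "row_weight l = row_weight (remove_box l r) + r"
proof -
  have pos: "0 < l r" using assms(2) by (rule corner_pos)
  have "finite (cells l)" using assms(1) by (simp add: is_partition_def)
  then have fin: "finite (cells (remove_box l r))"
    using cells_remove_box(1)[of l r, OF pos] by (metis finite_insert)
  show ?thesis
    unfolding row_weight_def
    by (subst cells_remove_box(1)[of l r, OF pos]) (use fin cells_remove_box(2)[of l r, OF pos] in simp)
qed

text \<open>The first boxes of these rows embed them into the diagram. For \<open>m = 0\<close> the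
  set would be infinite.\<close>

lemma card_rows_le:
  assumes "is_partition n l" "0 < m"
  shows "finite {i. m \<le> l i}" "card {i. m \<le> l i} \<le> n"
proof -
  have sub: "(\<lambda>i. (i, 0::nat)) ` {i. m \<le> l i} \<subseteq> cells l" using assms(2) by auto
  have inj: "inj_on (\<lambda>i. (i, 0::nat)) {i. m \<le> l i}" by (auto simp: inj_on_def)
  have fin: "finite (cells l)" "card (cells l) = n" using assms(1) by (auto simp: is_partition_def)
  show "finite {i. m \<le> l i}"
    using finite_subset[OF sub fin(1)] inj by (simp add: finite_image_iff)
  show "card {i. m \<le> l i} \<le> n"
    using card_mono[OF fin(1) sub] inj fin(2) by (simp add: card_image)
qed

text \<open>Monotonicity makes all rows up to \<open>r\<close> nonempty, so there are at least
  \<open>r + 1\<close> boxes. This keeps the exponent \<open>n - r\<close> exact.\<close>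

lemma corner_le:
  assumes "is_partition (Suc n) l" "corner l r"
  shows "r \<le> n"
proof -
  have "{..r} \<subseteq> {i. 1 \<le> l i}"
  proof
    fix i assume "i \<in> {..r}"
    then have "l r \<le> l i" using assms(1) by (simp add: is_partition_def antimonoD)
    then show "i \<in> {i. 1 \<le> l i}" using corner_pos[OF assms(2)] by simp
  qed
  moreover have "finite {i. 1 \<le> l i}" "card {i. 1 \<le> l i} \<le> Suc n"
    using card_rows_le[OF assms(1), of 1] by simp_all
  ultimately have "card {..r} \<le> card {i. 1 \<le> l i}" by (intro card_mono)
  also have "\<dots> \<le> Suc n" by fact
  finally show ?thesis by simp
qed

lemma finite_corners:
  assumes "is_partition n l"
  shows "finite {r. corner l r}"
  by (rule finite_subset[OF _ card_rows_le(1)[OF assms, of 1]]) (auto simp: corner_def)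

text \<open>A partition shape without corners has constant row length, hence its diagram is empty or
  infinite.\<close>

lemma ex_corner:
  assumes "is_partition (Suc n) l"
  shows "\<exists>r. corner l r"
proof (rule ccontr)
  assume no: "\<not> ?thesis"
  have const: "l i = l 0" for i
  proof (induction i)
    case (Suc i)
    have "l (Suc i) \<le> l i" using assms by (simp add: is_partition_def antimonoD)
    then show ?case using no Suc by (metis corner_def le_antisym not_less)
  qed simp
  have "cells l \<noteq> {}" using assms by (auto simp: is_partition_def)
  then obtain i j where "j < l i" by (auto simp: cells_def)
  then have "1 \<le> l k" for k using const[of i] const[of k] by simp
  then have "{i. 1 \<le> l i} = UNIV" by blast
  then show False using card_rows_le(1)[OF assms, of 1] by simp
qed

text \<open>Rows above \<open>r\<close> have length at least \<open>l r\<close>, rows below at most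
  \<open>l (Suc r) < l r\<close>. These \<open>r\<close> rows are the codimension behind the leading
  exponent \<open>n - r\<close> of \<open>box_poly\<close>.\<close>

lemma card_longer_rows:
  assumes "is_partition (Suc n) l" "corner l r"
  shows "{i. l r - 1 < remove_box l r i} = {..<r}"
proof -
  have anti: "i \<le> j \<Longrightarrow> l j \<le> l i" for i j
    using assms(1) by (simp add: is_partition_def antimonoD)
  have "l r - 1 < remove_box l r i \<longleftrightarrow> i < r" for i
  proof (cases i r rule: linorder_cases)
    case less then show ?thesis using anti[of i r] corner_pos[OF assms(2)] by simp
  next
    case greater
    then have "l i \<le> l (Suc r)" using anti[of "Suc r" i] by simp
    then show ?thesis using greater assms(2) by (simp add: corner_def)
  qed simp
  then show ?thesis by auto
qed

text \<open>Row \<open>r\<close>, shortened to \<open>l r - 1\<close>, joins the \<open>r\<close>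
  longer rows above it. Hence the monomial subtracted in \<open>box_poly\<close> has smaller degree
  than the first one.\<close>

lemma corner_less_card:
  assumes "is_partition (Suc n) l" "corner l r" "l r \<noteq> 1"
  shows "r < card {i. l r - 1 \<le> remove_box l r i}" "card {i. l r - 1 \<le> remove_box l r i} \<le> n"
proof -
  have m: "0 < l r - 1" using corner_pos[OF assms(2)] assms(3) by simp
  note fin = card_rows_le[OF is_partition_remove_box[OF assms(1,2)] m]
  have "{..r} \<subseteq> {i. l r - 1 \<le> remove_box l r i}"
  proof
    fix i assume "i \<in> {..r}"
    then consider "i = r" | "i \<in> {..<r}" by fastforce
    then show "i \<in> {i. l r - 1 \<le> remove_box l r i}"
      by cases (use card_longer_rows[OF assms(1,2), symmetric] in auto)
  qed
  then have "card {..r} \<le> card {i. l r - 1 \<le> remove_box l r i}"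
    by (rule card_mono[OF fin(1)])
  then show "r < card {i. l r - 1 \<le> remove_box l r i}" by simp
  show "card {i. l r - 1 \<le> remove_box l r i} \<le> n" by (rule fin(2))
qed

lemma degree_box_poly:
  assumes "is_partition (Suc n) l" "corner l r"
  shows "degree (box_poly n l r) \<le> n - r" "Polynomial.coeff (box_poly n l r) (n - r) = 1"
proof -
  define s where "s = card {i. l r - 1 \<le> remove_box l r i}"
  have s: "n - s < n - r" if "l r \<noteq> 1"
    using corner_less_card[OF assms that] unfolding s_def by linarith
  have "box_poly n l r = Polynomial.monom 1 (n - r) - (if l r = 1 then 0 else Polynomial.monom 1 (n - s))"
    unfolding box_poly_def s_def ..
  note eq = this
  have "degree (if l r = 1 then 0 else Polynomial.monom (1::int) (n - s)) \<le> n - r"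
    using s degree_monom_le[of "1::int" "n - s"] by (cases "l r = 1") auto
  then show "degree (box_poly n l r) \<le> n - r"
    unfolding eq by (intro degree_diff_le degree_monom_le)
  show "Polynomial.coeff (box_poly n l r) (n - r) = 1"
    unfolding eq using s by (cases "l r = 1") (auto dest: less_imp_neq)
qed

section \<open>Branching rule for standard tableaux\<close>

lemma max_cell_is_corner:
  assumes l: "is_partition (Suc n) l" and T: "T \<in> syt l"
  obtains r where "corner l r" "T (r, l r - 1) = Suc n"
proof -
  have card: "card (cells l) = Suc n" using l by (simp add: is_partition_def)
  have bij: "bij_betw T (cells l) {1..Suc n}" using T card by (simp add: syt_def)
  then have "Suc n \<in> T ` cells l" by (auto simp: bij_betw_def)
  then obtain i j where ij: "j < l i" "T (i, j) = Suc n" by force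
  have le: "T (i', j') \<le> Suc n" if "j' < l i'" for i' j'
  proof -
    have "T (i', j') \<in> {1..Suc n}" using bij that by (auto simp: bij_betw_def)
    then show ?thesis by simp
  qed
  \<comment> \<open>Entries to the right of \<open>n + 1\<close> or below it would be larger, so its
    box ends its row and row \<open>i + 1\<close> is too short to reach below it.\<close>
  have "\<not> Suc j < l i"
  proof
    assume "Suc j < l i"
    then have "T (i, j) < T (i, Suc j)" using T ij unfolding syt_def mem_cells by blast
    then show False using le[OF \<open>Suc j < l i\<close>] ij by simp
  qed
  then have j: "j = l i - 1" using ij by simp
  have "\<not> j < l (Suc i)"
  proof
    assume "j < l (Suc i)"
    then have "T (i, j) < T (Suc i, j)" using T ij unfolding syt_def mem_cells by blast
    then show False using le[OF \<open>j < l (Suc i)\<close>] ij by simp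
  qed
  then have "corner l i" using ij j by (simp add: corner_def)
  then show ?thesis using that ij j by blast
qed

text \<open>Deleting the largest entry keeps all order conditions. Writing it back into a corner is
  harmless too, since nothing lies to the right of a corner or below it.\<close>

lemma bij_betw_syt_remove_box:
  assumes l: "is_partition (Suc n) l" and r: "corner l r"
  shows "bij_betw (\<lambda>T. restrict T (cells (remove_box l r)))
    {T \<in> syt l. T (r, l r - 1) = Suc n} (syt (remove_box l r))"
proof (rule bij_betw_byWitness[where f' = "\<lambda>T. T((r, l r - 1) := Suc n)"])
  let ?m = "remove_box l r" and ?c = "(r, l r - 1)"
  have pos: "0 < l r" using r by (rule corner_pos)
  note ins = cells_remove_box[of l r, OF pos]
  have card: "card (cells l) = Suc n" "card (cells ?m) = n"
    using l is_partition_remove_box[OF l r] by (simp_all add: is_partition_def)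
  have bij_iff: "bij_betw T (cells ?m) {1..n} \<longleftrightarrow> bij_betw T (cells l) {1..Suc n}"
    if "T ?c = Suc n" for T
  proof -
    have "{1..Suc n} = {1..n} \<union> {T ?c}" "cells l = cells ?m \<union> {?c}" using that ins(1) by auto
    moreover have "T ?c \<notin> {1..n}" using that by simp
    ultimately show ?thesis using notIn_Un_bij_betw3[OF ins(2), of T "{1..n}"] by simp
  qed
  show "\<forall>T\<in>{T \<in> syt l. T ?c = Suc n}. (restrict T (cells ?m))(?c := Suc n) = T"
  proof
    fix T assume "T \<in> {T \<in> syt l. T ?c = Suc n}"
    then have "T \<in> extensional (insert ?c (cells ?m))" "T ?c = Suc n"
      unfolding syt_def using ins(1) by auto
    then show "(restrict T (cells ?m))(?c := Suc n) = T"
      by (auto simp: fun_eq_iff extensional_def)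
  qed
  show "\<forall>T\<in>syt ?m. restrict (T(?c := Suc n)) (cells ?m) = T"
  proof
    fix T assume "T \<in> syt ?m"
    then have "T \<in> extensional (cells ?m)" unfolding syt_def by auto
    then show "restrict (T(?c := Suc n)) (cells ?m) = T"
      using ins(2) by (auto simp: fun_eq_iff extensional_def restrict_def)
  qed
  show "(\<lambda>T. restrict T (cells ?m)) ` {T \<in> syt l. T ?c = Suc n} \<subseteq> syt ?m"
  proof (clarify)
    fix T assume T: "T \<in> syt l" "T ?c = Suc n"
    have "bij_betw T (cells ?m) {1..n}" using T card bij_iff by (simp add: syt_def)
    then have "bij_betw (restrict T (cells ?m)) (cells ?m) {1..n}" by (simp add: bij_betw_restrict_eq)
    moreover have "cells ?m \<subseteq> cells l" using ins(1) by auto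
    ultimately show "restrict T (cells ?m) \<in> syt ?m"
      using T card(2) unfolding syt_def by (simp add: subset_iff)
  qed
  show "(\<lambda>T. T(?c := Suc n)) ` syt ?m \<subseteq> {T \<in> syt l. T ?c = Suc n}"
  proof (clarify)
    fix T assume T: "T \<in> syt ?m"
    let ?T = "T(?c := Suc n)"
    have bij: "bij_betw T (cells ?m) {1..n}" using T card by (simp add: syt_def)
    have "bij_betw ?T (cells ?m) {1..n}"
      using bij ins(2) by (subst bij_betw_cong[where g = T]) auto
    then have bij': "bij_betw ?T (cells l) {1..card (cells l)}" using bij_iff[of ?T] card(1) by simp
    have le: "T (i, j) < Suc n" if "(i, j) \<in> cells ?m" for i j
    proof -
      have "T (i, j) \<in> {1..n}" using bij that unfolding bij_betw_def by blast
      then show ?thesis by simp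
    qed
    have m_iff: "(i, j) \<in> cells l \<longleftrightarrow> (i, j) = ?c \<or> (i, j) \<in> cells ?m" for i j
      using ins(1) by auto
    have "T \<in> extensional (cells ?m)" using T unfolding syt_def by blast
    then have "?T p = undefined" if "p \<notin> cells l" for p
      using that ins(1) extensional_arb[of T "cells ?m" p] by force
    then have ext: "?T \<in> extensional (cells l)" unfolding extensional_def by blast
    have row: "?T (i, j) < ?T (i, j')"
      if ij: "(i, j) \<in> cells l" "(i, j') \<in> cells l" "j < j'" for i j j'
    proof -
      have "(i, j) \<noteq> ?c" using that by auto
      then have m: "(i, j) \<in> cells ?m" using ij(1) m_iff by blast
      show ?thesis
      proof (cases "(i, j') = ?c")
        case True then show ?thesis using le[OF m] \<open>(i, j) \<noteq> ?c\<close> by (simp del: mem_cells)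
      next
        case False
        then have "(i, j') \<in> cells ?m" using ij(2) m_iff by blast
        then have "T (i, j) < T (i, j')" using T m \<open>j < j'\<close> unfolding syt_def by blast
        then show ?thesis using False \<open>(i, j) \<noteq> ?c\<close> by auto
      qed
    qed
    have col: "?T (i, j) < ?T (i', j)"
      if ij: "(i, j) \<in> cells l" "(i', j) \<in> cells l" "i < i'" for i i' j
    proof -
      have "(i, j) \<noteq> ?c"
      proof
        assume "(i, j) = ?c"
        then have "l i' \<le> l (Suc r)" using l ij by (simp add: is_partition_def antimonoD)
        then show False using r ij \<open>(i, j) = ?c\<close> by (simp add: corner_def)
      qed
      then have m: "(i, j) \<in> cells ?m" using ij(1) m_iff by blast
      show ?thesis
      proof (cases "(i', j) = ?c")
        case True then show ?thesis using le[OF m] \<open>(i, j) \<noteq> ?c\<close> by (simp del: mem_cells)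
      next
        case False
        then have "(i', j) \<in> cells ?m" using ij(2) m_iff by blast
        then have "T (i, j) < T (i', j)" using T m \<open>i < i'\<close> unfolding syt_def by blast
        then show ?thesis using False \<open>(i, j) \<noteq> ?c\<close> by auto
      qed
    qed
    have "?T \<in> syt l" unfolding syt_def using ext bij' row col by blast
    then show "?T \<in> syt l \<and> ?T ?c = Suc n" by simp
  qed
qed

lemma finite_syt: "finite (cells l) \<Longrightarrow> finite (syt l)"
  by (rule finite_subset[of _ "cells l \<rightarrow>\<^sub>E {1..card (cells l)}"], force simp: PiE_def syt_def bij_betw_def)
    (simp add: finite_PiE)

text \<open>Tableaux are sorted by the corner that carries \<open>n + 1\<close>; the classes are
  disjoint because a tableau is injective.\<close>

lemma card_syt_recurrence:
  assumes l: "is_partition (Suc n) l"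
  shows "card (syt l) = (\<Sum>r | corner l r. card (syt (remove_box l r)))"
proof -
  define S where "S r = {T \<in> syt l. T (r, l r - 1) = Suc n}" for r
  have fin: "finite (cells l)" "card (cells l) = Suc n" using l by (auto simp: is_partition_def)
  have "syt l = (\<Union>r\<in>{r. corner l r}. S r)"
    using max_cell_is_corner[OF l] unfolding S_def by blast
  moreover have "card (\<Union>r\<in>{r. corner l r}. S r) = (\<Sum>r | corner l r. card (S r))"
  proof (rule card_UN_disjoint)
    show "finite {r. corner l r}" using l by (rule finite_corners)
    show "\<forall>r\<in>{r. corner l r}. finite (S r)" using finite_syt[OF fin(1)] by (simp add: S_def)
    show "\<forall>r\<in>{r. corner l r}. \<forall>r'\<in>{r. corner l r}. r \<noteq> r' \<longrightarrow> S r \<inter> S r' = {}"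
    proof (clarify, rule equals0I)
      fix r r' T assume r: "corner l r" "corner l r'" "r \<noteq> r'" and "T \<in> S r \<inter> S r'"
      then have "inj_on T (cells l)" "T (r, l r - 1) = T (r', l r' - 1)"
        by (auto simp: S_def syt_def bij_betw_def)
      then have "(r, l r - 1) = (r', l r' - 1)"
        using r(1,2)[THEN corner_pos] by (elim inj_onD) auto
      then show False using r by simp
    qed
  qed
  moreover have "card (S r) = card (syt (remove_box l r))" if "corner l r" for r
    using bij_betw_same_card[OF bij_betw_syt_remove_box[OF l that]] by (simp add: S_def)
  ultimately show ?thesis by simp
qed

lemma card_syt_empty:
  assumes "is_partition 0 l"
  shows "card (syt l) = 1"
proof -
  have "cells l = {}" using assms by (auto simp: is_partition_def)
  then have "syt l = {\<lambda>_. undefined}"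
    unfolding syt_def by (simp del: mem_cells add: bij_betw_def extensional_empty)
  then show ?thesis by simp
qed

text \<open>Positivity is what later turns the degree bound into the exact degree.\<close>

lemma card_syt_pos: "is_partition n l \<Longrightarrow> 0 < card (syt l)"
proof (induction n arbitrary: l)
  case 0 then show ?case by (simp add: card_syt_empty)
next
  case (Suc n)
  obtain r where r: "corner l r" using ex_corner[OF Suc.prems] by blast
  have "0 < card (syt (remove_box l r))"
    using Suc.IH[OF is_partition_remove_box[OF Suc.prems r]] .
  also have "\<dots> \<le> card (syt l)"
    unfolding card_syt_recurrence[OF Suc.prems]
    using r finite_corners[OF Suc.prems] by (intro member_le_sum) auto
  finally show ?case .
qed

section \<open>Degree and top coefficient of the recursive polynomial\<close>

lemma coeff_mult_top:
  assumes "degree p \<le> a" "degree q \<le> b"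
  shows "Polynomial.coeff (p * q) (a + b) = Polynomial.coeff p a * Polynomial.coeff q b"
proof (cases "degree p = a \<and> degree q = b")
  case True then show ?thesis using coeff_mult_degree_sum by blast
next
  \<comment> \<open>Some bound is not attained, and then both sides vanish.\<close>
  case False
  then have "degree (p * q) < a + b" "degree p < a \<or> degree q < b"
    using assms degree_mult_le[of p q] by linarith+
  then show ?thesis by (auto simp: coeff_eq_0)
qed

text \<open>A degree bound together with the coefficient at that bound is a form stable under sums.
  The inequality is carried along so that the truncated subtraction stays exact.\<close>

lemma jpoly_top:
  assumes "is_partition n l"
  shows "row_weight l \<le> n choose 2 \<and> degree (jpoly n l) \<le> (n choose 2) - row_weight l \<and>
    Polynomial.coeff (jpoly n l) ((n choose 2) - row_weight l) = int (card (syt l))"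
  using assms
proof (induction n arbitrary: l)
  case 0
  then have "cells l = {}" by (auto simp: is_partition_def)
  then show ?case using card_syt_empty[OF 0] by (simp add: row_weight_def)
next
  case (Suc n)
  let ?d = "(Suc n choose 2) - row_weight l"
  have choose: "Suc n choose 2 = (n choose 2) + n" by (simp add: numeral_2_eq_2)
  have step: "row_weight l \<le> Suc n choose 2 \<and>
      degree (box_poly n l r * jpoly n (remove_box l r)) \<le> ?d \<and>
      Polynomial.coeff (box_poly n l r * jpoly n (remove_box l r)) ?d
        = int (card (syt (remove_box l r)))"
    if r: "corner l r" for r
  proof -
    let ?e = "(n choose 2) - row_weight (remove_box l r)"
    note IH = Suc.IH[OF is_partition_remove_box[OF Suc.prems r]]
    note box = degree_box_poly[OF Suc.prems r]
    have "r \<le> n" using corner_le[OF Suc.prems r] .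
    moreover have "row_weight l = row_weight (remove_box l r) + r"
      by (rule row_weight_remove_box[OF Suc.prems r])
    \<comment> \<open>The exponent lost in \<open>box_poly\<close> is \<open>r\<close>, exactly the
      weight of the removed box. So every corner reaches the same top degree \<open>?d\<close>, and
      the top coefficients simply add.\<close>
    ultimately have d: "?d = (n - r) + ?e" and le: "row_weight l \<le> Suc n choose 2"
      using IH choose by linarith+
    have deg: "degree (box_poly n l r * jpoly n (remove_box l r)) \<le> ?d"
      unfolding d using degree_mult_le[of "box_poly n l r" "jpoly n (remove_box l r)"] box(1) IH
      by linarith
    have "Polynomial.coeff (box_poly n l r * jpoly n (remove_box l r)) ?d
        = Polynomial.coeff (box_poly n l r) (n - r) * Polynomial.coeff (jpoly n (remove_box l r)) ?e"
      unfolding d by (intro coeff_mult_top box(1)) (use IH in blast)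
    moreover have "Polynomial.coeff (jpoly n (remove_box l r)) ?e = int (card (syt (remove_box l r)))"
      using IH by blast
    ultimately have "Polynomial.coeff (box_poly n l r * jpoly n (remove_box l r)) ?d
        = int (card (syt (remove_box l r)))"
      unfolding box(2) by simp
    with le deg show ?thesis by blast
  qed
  obtain r where r: "corner l r" using ex_corner[OF Suc.prems] by blast
  have "degree (jpoly (Suc n) l) \<le> ?d"
    using step finite_corners[OF Suc.prems] by (auto intro!: degree_sum_le)
  moreover have "Polynomial.coeff (jpoly (Suc n) l) ?d = int (card (syt l))"
    using step by (simp add: coeff_sum card_syt_recurrence[OF Suc.prems])
  ultimately show ?case using step[OF r] by blast
qed

section \<open>Partitions are determined by the sizes of their first columns\<close>

lemma lower_set_eq_lessThan:
  fixes S :: "nat set"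
  assumes "finite S" "\<And>i j. i \<in> S \<Longrightarrow> j \<le> i \<Longrightarrow> j \<in> S"
  shows "S = {..<card S}"
proof -
  have "\<exists>m. S = {..<m}"
  proof (cases "S = {}")
    case False
    have "S = {..<Suc (Max S)}"
    proof (intro Set.set_eqI iffI)
      fix x assume "x \<in> {..<Suc (Max S)}"
      then show "x \<in> S" using assms(2)[OF Max_in[OF assms(1) False], of x] by simp
    qed (simp add: assms(1) less_Suc_eq_le)
    then show ?thesis by blast
  qed auto
  then show ?thesis by fastforce
qed

text \<open>Consecutive differences of these counts are the column lengths, and each column is an
  initial segment of the rows. The counts will appear as dimensions of kernels of powers.\<close>

lemma partition_eqI:
  assumes l: "is_partition n l" and l': "is_partition n' l'"
    and eq: "\<And>k. card {(i, j). j < l i \<and> j < k} = card {(i, j). j < l' i \<and> j < k}"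
  shows "l = l'"
proof -
  have rows: "{i. k < h i} = {..<card {(i, j). j < h i \<and> j < Suc k} - card {(i, j). j < h i \<and> j < k}}"
    if h: "is_partition m h" for h k m
  proof -
    have fin: "finite {(i, j). j < h i \<and> j < k}"
      by (rule finite_subset[of _ "cells h"]) (use h in \<open>auto simp: is_partition_def\<close>)
    have fin': "finite {i. k < h i}" using card_rows_le(1)[OF h, of "Suc k"] by (simp add: Suc_le_eq)
    have "{(i, j). j < h i \<and> j < Suc k} = {(i, j). j < h i \<and> j < k} \<union> (\<lambda>i. (i, k)) ` {i. k < h i}"
      by (auto simp: less_Suc_eq)
    then have "card {(i, j). j < h i \<and> j < Suc k}
        = card {(i, j). j < h i \<and> j < k} + card ((\<lambda>i. (i, k)) ` {i. k < h i})"
      using fin fin' by (simp add: card_Un_disjoint disjoint_iff image_iff)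
    also have "card ((\<lambda>i. (i, k)) ` {i. k < h i}) = card {i. k < h i}"
      by (rule card_image) (auto simp: inj_on_def)
    finally have "card {(i, j). j < h i \<and> j < Suc k} - card {(i, j). j < h i \<and> j < k} = card {i. k < h i}"
      by simp
    moreover have "{i. k < h i} = {..<card {i. k < h i}}"
    proof (rule lower_set_eq_lessThan[OF fin'])
      fix i j assume "i \<in> {i. k < h i}" "j \<le> i"
      moreover have "h i \<le> h j" using h \<open>j \<le> i\<close> by (simp add: is_partition_def antimonoD)
      ultimately show "j \<in> {i. k < h i}" by simp
    qed
    ultimately show ?thesis by simp
  qed
  have "{i. k < l i} = {i. k < l' i}" for k using rows[OF l] rows[OF l'] eq by simp
  then have "k < l i \<longleftrightarrow> k < l' i" for k i by (simp add: set_eq_iff)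
  then show ?thesis by (intro ext) (metis less_irrefl linorder_neqE_nat)
qed

lemma cells_add_box:
  "cells (l(r := Suc (l r))) = insert (r, l r) (cells l)" "(r, l r) \<notin> cells l"
  by (auto simp: cells_def split: if_splits)

section \<open>Passage from lists of parts to row functions\<close>

definition row_len :: "nat list \<Rightarrow> nat \<Rightarrow> nat" where
  "row_len la i = (if i < length la then la ! i else 0)"

lemma row_len_Cons [simp]: "row_len (k # ks) 0 = k" "row_len (k # ks) (Suc i) = row_len ks i"
  by (simp_all add: row_len_def)

lemma cells_row_len: "cells (row_len la) = (SIGMA i:{..<length la}. {..<la ! i})"
  by (auto simp: cells_def row_len_def split: if_splits)

lemma finite_cells_row_len: "finite (cells (row_len la))"
  by (simp add: cells_row_len)

lemma card_cells_row_len: "card (cells (row_len la)) = sum_list la"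
  by (simp add: cells_row_len sum_list_sum_nth atLeast0LessThan)

lemma is_partition_row_len:
  assumes "partition_of la n"
  shows "is_partition n (row_len la)"
proof -
  have "antimono (row_len la)"
  proof (rule antimonoI)
    fix i j :: nat assume "i \<le> j"
    moreover have "la ! j \<le> la ! i" if "i < j" "j < length la"
      using assms that by (simp add: partition_of_def sorted_wrt_iff_nth_less)
    ultimately show "row_len la j \<le> row_len la i" by (auto simp: row_len_def le_less)
  qed
  then show ?thesis
    using assms by (simp add: is_partition_def finite_cells_row_len card_cells_row_len partition_of_def)
qed

lemma row_weight_row_len: "row_weight (row_len la) = partition_n la"
proof -
  have "row_weight (row_len la) = (\<Sum>i<length la. \<Sum>j<la ! i. i)"
    unfolding row_weight_def cells_row_len by (rule sum.Sigma[symmetric]) auto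
  then show ?thesis by (simp add: partition_n_def mult.commute)
qed

lemma standard_tableaux_eq_syt: "standard_tableaux la = syt (row_len la)"
proof -
  have "young_diagram la = cells (row_len la)"
    by (auto simp: young_diagram_def cells_def row_len_def split: if_splits)
  then show ?thesis unfolding standard_tableaux_def syt_def card_cells_row_len by simp
qed

section \<open>Nilpotent Jordan types over a finite field\<close>

text \<open>Finiteness lets counting take the place of dimension theory: the cardinality of a space
  is a power of the field size.\<close>

locale fin_field = field K for K :: "('a, 'b) ring_scheme" (structure) +
  assumes finite_carrier: "finite (carrier K)"
begin

text \<open>
  Vectors indexed by \<open>I\<close> vanish outside \<open>I\<close>, which keeps the pointwise operations closed.
\<close>

definition vecs :: "'i set \<Rightarrow> ('i \<Rightarrow> 'a) set" where
  "vecs I = {x. (\<forall>i. x i \<in> carrier K) \<and> (\<forall>i. i \<notin> I \<longrightarrow> x i = \<zero>)}"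

abbreviation vzero :: "'i \<Rightarrow> 'a" where
  "vzero \<equiv> \<lambda>_. \<zero>"

definition vadd :: "('i \<Rightarrow> 'a) \<Rightarrow> ('i \<Rightarrow> 'a) \<Rightarrow> 'i \<Rightarrow> 'a" where
  "vadd x y = (\<lambda>i. x i \<oplus> y i)"

definition vscale :: "'a \<Rightarrow> ('i \<Rightarrow> 'a) \<Rightarrow> 'i \<Rightarrow> 'a" where
  "vscale a x = (\<lambda>i. a \<otimes> x i)"

definition linear_map :: "'i set \<Rightarrow> 'j set \<Rightarrow> (('i \<Rightarrow> 'a) \<Rightarrow> 'j \<Rightarrow> 'a) \<Rightarrow> bool" where
  "linear_map I J f \<longleftrightarrow> (\<forall>x\<in>vecs I. f x \<in> vecs J) \<and>
     (\<forall>x\<in>vecs I. \<forall>y\<in>vecs I. f (vadd x y) = vadd (f x) (f y)) \<and>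
     (\<forall>a\<in>carrier K. \<forall>x\<in>vecs I. f (vscale a x) = vscale a (f x))"

definition linear_iso :: "'i set \<Rightarrow> 'j set \<Rightarrow> (('i \<Rightarrow> 'a) \<Rightarrow> 'j \<Rightarrow> 'a) \<Rightarrow> bool" where
  "linear_iso I J f \<longleftrightarrow> linear_map I J f \<and> bij_betw f (vecs I) (vecs J)"

section \<open>Vectors and linear maps\<close>

lemma vecs_carrier: "x \<in> vecs I \<Longrightarrow> x i \<in> carrier K"
  by (simp add: vecs_def)

lemma vecs_outside: "x \<in> vecs I \<Longrightarrow> i \<notin> I \<Longrightarrow> x i = \<zero>"
  by (simp add: vecs_def)

lemma vecsI: "(\<And>i. x i \<in> carrier K) \<Longrightarrow> (\<And>i. i \<notin> I \<Longrightarrow> x i = \<zero>) \<Longrightarrow> x \<in> vecs I"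
  by (simp add: vecs_def)

lemma vzero_vecs [simp]: "vzero \<in> vecs I"
  by (simp add: vecs_def)

lemma vadd_vecs [simp]: "x \<in> vecs I \<Longrightarrow> y \<in> vecs I \<Longrightarrow> vadd x y \<in> vecs I"
  by (simp add: vecs_def vadd_def)

lemma vscale_vecs [simp]: "a \<in> carrier K \<Longrightarrow> x \<in> vecs I \<Longrightarrow> vscale a x \<in> vecs I"
  by (simp add: vecs_def vscale_def)

lemma linear_mapI:
  assumes "\<And>x. x \<in> vecs I \<Longrightarrow> f x \<in> vecs J"
    and "\<And>x y i. x \<in> vecs I \<Longrightarrow> y \<in> vecs I \<Longrightarrow> f (vadd x y) i = f x i \<oplus> f y i"
    and "\<And>a x i. a \<in> carrier K \<Longrightarrow> x \<in> vecs I \<Longrightarrow> f (vscale a x) i = a \<otimes> f x i"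
  shows "linear_map I J f"
  using assms unfolding linear_map_def by (auto simp: fun_eq_iff vadd_def vscale_def)

lemma linear_mapD:
  assumes "linear_map I J f" "x \<in> vecs I"
  shows "f x \<in> vecs J" "y \<in> vecs I \<Longrightarrow> f (vadd x y) = vadd (f x) (f y)"
    "a \<in> carrier K \<Longrightarrow> f (vscale a x) = vscale a (f x)"
  using assms by (simp_all add: linear_map_def)

lemma vscale_zero: "x \<in> vecs I \<Longrightarrow> vscale \<zero> x = vzero"
  by (simp add: vscale_def vecs_carrier fun_eq_iff)

lemma linear_map_zero:
  assumes "linear_map I J f"
  shows "f vzero = vzero"
proof -
  have "f vzero = f (vscale \<zero> vzero)" by (simp add: vscale_def)
  also have "\<dots> = vscale \<zero> (f vzero)" using linear_mapD[OF assms, of vzero] by simp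
  also have "\<dots> = vzero" using linear_mapD(1)[OF assms, of vzero] vscale_zero by simp
  finally show ?thesis .
qed

lemma linear_map_comp:
  "linear_map I J f \<Longrightarrow> linear_map J L g \<Longrightarrow> linear_map I L (\<lambda>x. g (f x))"
  by (simp add: linear_map_def)

lemma linear_iso_comp:
  assumes "linear_iso I J f" "linear_iso J L g"
  shows "linear_iso I L (\<lambda>x. g (f x))"
  using assms linear_map_comp[of I J f L g] bij_betw_trans[of f "vecs I" "vecs J" g "vecs L"]
  by (simp add: linear_iso_def comp_def)

lemma linear_iso_inv:
  assumes "linear_iso I J f"
  shows "linear_iso J I (inv_into (vecs I) f)"
proof -
  let ?g = "inv_into (vecs I) f"
  have f: "linear_map I J f" "bij_betw f (vecs I) (vecs J)"
    using assms by (auto simp: linear_iso_def)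
  have g: "bij_betw ?g (vecs J) (vecs I)" using f(2) by (rule bij_betw_inv_into)
  have fg: "f (?g y) = y" and gy: "?g y \<in> vecs I" if "y \<in> vecs J" for y
    using f(2) g that by (auto simp: bij_betw_inv_into_right dest: bij_betwE)
  have gf: "?g (f x) = x" if "x \<in> vecs I" for x
    using f(2) that by (simp add: bij_betw_inv_into_left)
  have "?g (vadd x y) = vadd (?g x) (?g y)" if "x \<in> vecs J" "y \<in> vecs J" for x y
    using linear_mapD(2)[OF f(1), of "?g x" "?g y"] gf[of "vadd (?g x) (?g y)"] that fg gy by simp
  moreover have "?g (vscale a y) = vscale a (?g y)" if "a \<in> carrier K" "y \<in> vecs J" for a y
    using linear_mapD(3)[OF f(1), of "?g y" a] gf[of "vscale a (?g y)"] that fg gy by simp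
  ultimately show ?thesis using g gy by (simp add: linear_iso_def linear_map_def)
qed

lemma card_vecs:
  assumes "finite I"
  shows "finite (vecs I)" "card (vecs I) = card (carrier K) ^ card I"
proof -
  have bij: "bij_betw (\<lambda>x. restrict x I) (vecs I) (I \<rightarrow>\<^sub>E carrier K)"
    by (rule bij_betw_byWitness[where f' = "\<lambda>x i. if i \<in> I then x i else \<zero>"])
      (auto simp: vecs_def fun_eq_iff PiE_iff extensional_def)
  have fin: "finite (I \<rightarrow>\<^sub>E carrier K)" using assms finite_carrier by (simp add: finite_PiE)
  show "finite (vecs I)" using bij_betw_finite[OF bij] fin by blast
  show "card (vecs I) = card (carrier K) ^ card I"
    using bij_betw_same_card[OF bij] assms by (simp add: card_PiE)
qed

lemma card_carrier_gt_1: "1 < card (carrier K)"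
proof -
  have "card {\<zero>, \<one>} \<le> card (carrier K)" using finite_carrier by (intro card_mono) auto
  then show ?thesis using zero_not_one by simp
qed

text \<open>A trivial kernel gives injectivity, and injectivity between finite spaces of equal
  cardinality gives surjectivity.\<close>

lemma linear_iso_of_kernel:
  assumes f: "linear_map I J f" and fin: "finite I" "finite J" "card I = card J"
    and ker: "\<And>x. x \<in> vecs I \<Longrightarrow> f x = vzero \<Longrightarrow> x = vzero"
  shows "linear_iso I J f"
proof -
  have "inj_on f (vecs I)"
  proof (rule inj_onI)
    fix x y assume xy: "x \<in> vecs I" "y \<in> vecs I" "f x = f y"
    \<comment> \<open>Differences are written as sums with the multiple by minus one, the form to
      which linearity of \<open>f\<close> applies.\<close>
    let ?m = "\<ominus> \<one>"
    have m: "?m \<in> carrier K" by simp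
    have eq0: "vadd u (vscale ?m v) = vzero \<longleftrightarrow> u = v" if "u \<in> vecs L" "v \<in> vecs L" for u v :: "'c \<Rightarrow> 'a" and L
    proof -
      have "u i \<oplus> ?m \<otimes> v i = \<zero> \<longleftrightarrow> u i = v i" for i
        using that[THEN vecs_carrier, of i] by (simp add: l_minus flip: a_minus_def)
      then show ?thesis by (simp add: vadd_def vscale_def fun_eq_iff)
    qed
    have "f (vadd x (vscale ?m y)) = vadd (f x) (vscale ?m (f y))"
      using xy linear_mapD[OF f] m by simp
    also have "\<dots> = vzero"
    proof -
      have "f x i \<oplus> ?m \<otimes> f y i = \<zero>" for i
        using xy linear_mapD(1)[OF f xy(2), THEN vecs_carrier, of i] by (simp add: l_minus r_neg)
      then show ?thesis by (simp add: vadd_def vscale_def)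
    qed
    finally have "vadd x (vscale ?m y) = vzero" using ker xy m by simp
    then show "x = y" using eq0 xy by blast
  qed
  moreover have "f ` vecs I = vecs J"
  proof (rule card_subset_eq)
    show "finite (vecs J)" by (rule card_vecs[OF fin(2)])
    show "f ` vecs I \<subseteq> vecs J" using linear_mapD(1)[OF f] by blast
    show "card (f ` vecs I) = card (vecs J)"
      using card_image[OF \<open>inj_on f (vecs I)\<close>] card_vecs(2)[OF fin(1)] card_vecs(2)[OF fin(2)] fin(3) by simp
  qed
  ultimately show ?thesis using f by (simp add: linear_iso_def bij_betw_def)
qed

section \<open>Jordan coordinates and uniqueness of the Jordan type\<close>

definition shift :: "(nat \<times> nat \<Rightarrow> 'a) \<Rightarrow> nat \<times> nat \<Rightarrow> 'a" where
  "shift x = (\<lambda>(i, j). x (i, Suc j))"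

lemma shift_apply [simp]: "shift x (i, j) = x (i, Suc j)"
  by (simp add: shift_def)

lemma shift_vecs [simp]: "x \<in> vecs (cells l) \<Longrightarrow> shift x \<in> vecs (cells l)"
  by (auto simp: vecs_def)

lemma funpow_shift: "(shift ^^ k) x (i, j) = x (i, j + k)"
  by (induction k arbitrary: j) auto

text \<open>
  The box \<open>(i, j)\<close> stands for the \<open>j\<close>-th vector of the \<open>i\<close>-th Jordan chain, so in coordinates the
  nilpotent operator is \<open>shift\<close>.
\<close>

definition has_jordan_type :: "nat \<Rightarrow> ((nat \<Rightarrow> 'a) \<Rightarrow> nat \<Rightarrow> 'a) \<Rightarrow> (nat \<Rightarrow> nat) \<Rightarrow> bool" where
  "has_jordan_type n T l \<longleftrightarrow> (\<exists>\<phi>. linear_iso (cells l) {..<n} \<phi> \<and>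
     (\<forall>z\<in>vecs (cells l). T (\<phi> z) = \<phi> (shift z)))"

text \<open>As \<open>shift\<close> moves every entry one column to the left, the kernel of the
  \<open>k\<close>-th power consists, in coordinates, of the vectors supported on the first
  \<open>k\<close> columns.\<close>

lemma card_kernel_funpow:
  assumes "has_jordan_type n T l" "finite (cells l)"
  shows "card {x \<in> vecs {..<n}. (T ^^ k) x = vzero} = card (carrier K) ^ card {(i, j). j < l i \<and> j < k}"
proof -
  obtain \<phi> where phi: "linear_iso (cells l) {..<n} \<phi>"
    "\<And>z. z \<in> vecs (cells l) \<Longrightarrow> T (\<phi> z) = \<phi> (shift z)"
    using assms by (auto simp: has_jordan_type_def)
  have lin: "linear_map (cells l) {..<n} \<phi>" and bij: "bij_betw \<phi> (vecs (cells l)) (vecs {..<n})"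
    using phi by (auto simp: linear_iso_def)
  have pow: "(T ^^ k) (\<phi> z) = \<phi> ((shift ^^ k) z) \<and> (shift ^^ k) z \<in> vecs (cells l)"
    if "z \<in> vecs (cells l)" for z k
    using that by (induction k) (auto simp: phi(2))
  have "(T ^^ k) (\<phi> z) = vzero \<longleftrightarrow> (shift ^^ k) z = vzero" if z: "z \<in> vecs (cells l)" for z
  proof -
    have "\<phi> ((shift ^^ k) z) = \<phi> vzero \<longleftrightarrow> (shift ^^ k) z = vzero"
      using bij pow[OF z, of k] by (intro inj_on_eq_iff) (auto simp: bij_betw_def)
    then show ?thesis using pow[OF z] linear_map_zero[OF lin] by simp
  qed
  moreover have "(shift ^^ k) z = vzero \<longleftrightarrow> z \<in> vecs {(i, j). j < l i \<and> j < k}"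
    if z: "z \<in> vecs (cells l)" for z
  proof
    assume eq: "(shift ^^ k) z = vzero"
    show "z \<in> vecs {(i, j). j < l i \<and> j < k}"
    proof (rule vecsI)
      show "z p \<in> carrier K" for p using z by (rule vecs_carrier)
      fix p :: "nat \<times> nat"
      assume p: "p \<notin> {(i, j). j < l i \<and> j < k}"
      obtain i j where ij: "p = (i, j)" by (cases p)
      show "z p = \<zero>"
      proof (cases "j < l i")
        case True
        \<comment> \<open>A box outside the first \<open>k\<close> columns has
          \<open>k \<le> j\<close>, so its entry reappears in \<open>(shift ^^ k) z\<close> at
          \<open>(i, j - k)\<close>.\<close>
        then have "j - k + k = j" using p ij by simp
        then show ?thesis using fun_cong[OF eq, of "(i, j - k)"] ij by (simp add: funpow_shift)
      qed (use vecs_outside[OF z] ij in auto)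
    qed
  next
    assume "z \<in> vecs {(i, j). j < l i \<and> j < k}"
    then show "(shift ^^ k) z = vzero" by (auto simp: fun_eq_iff funpow_shift vecs_def)
  qed
  ultimately have "bij_betw \<phi> {z \<in> vecs (cells l). z \<in> vecs {(i, j). j < l i \<and> j < k}}
      {x \<in> vecs {..<n}. (T ^^ k) x = vzero}"
    using bij by (intro bij_betw_Collect) auto
  moreover have "{z \<in> vecs (cells l). z \<in> vecs {(i, j). j < l i \<and> j < k}} = vecs {(i, j). j < l i \<and> j < k}"
    by (auto simp: vecs_def)
  moreover have "finite {(i, j). j < l i \<and> j < k}"
    using assms(2) by (rule rev_finite_subset) auto
  ultimately show ?thesis
    using card_vecs(2)[of "{(i, j). j < l i \<and> j < k}"] by (simp add: bij_betw_same_card[symmetric])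
qed

text \<open>The kernel sizes of the powers depend on \<open>T\<close> only, and as powers of a base
  larger than one they determine their exponents.\<close>

lemma jordan_type_unique:
  assumes "has_jordan_type n T l" "has_jordan_type n T l'" "is_partition m l" "is_partition m' l'"
  shows "l = l'"
proof (rule partition_eqI[OF assms(3,4)])
  fix k
  have "card (carrier K) ^ card {(i, j). j < l i \<and> j < k} = card (carrier K) ^ card {(i, j). j < l' i \<and> j < k}"
    using card_kernel_funpow[OF assms(1), of k] card_kernel_funpow[OF assms(2), of k] assms(3,4)
    by (simp add: is_partition_def)
  then show "card {(i, j). j < l i \<and> j < k} = card {(i, j). j < l' i \<and> j < k}"
    using card_carrier_gt_1 by (simp add: power_inject_exp)
qed

text \<open>Reordering Jordan chains is a relabelling of coordinates. It serves to move a new box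
  between rows of equal length.\<close>

lemma has_jordan_type_swap_rows:
  assumes "has_jordan_type n T l"
  shows "has_jordan_type n T (l \<circ> Transposition.transpose p r)"
proof -
  let ?s = "Transposition.transpose p r"
  let ?h = "\<lambda>z (i, j). z (?s i, j :: nat) :: 'a"
  obtain \<phi> where phi: "linear_iso (cells l) {..<n} \<phi>"
    "\<And>z. z \<in> vecs (cells l) \<Longrightarrow> T (\<phi> z) = \<phi> (shift z)"
    using assms by (auto simp: has_jordan_type_def)
  have h: "?h z \<in> vecs (cells l')" if "z \<in> vecs (cells (l' \<circ> ?s))" for z l'
    using that by (auto simp: vecs_def)
  have hh: "?h (?h z) = z" for z by auto
  have "linear_map (cells (l \<circ> ?s)) (cells l) ?h"
    by (rule linear_mapI) (use h in \<open>auto simp: vadd_def vscale_def\<close>)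
  moreover have "bij_betw ?h (vecs (cells (l \<circ> ?s))) (vecs (cells l))"
  proof (rule bij_betw_byWitness[where f' = ?h])
    have "l \<circ> ?s \<circ> ?s = l" by (simp add: comp_assoc)
    then show "?h ` vecs (cells l) \<subseteq> vecs (cells (l \<circ> ?s))" using h[of _ "l \<circ> ?s"] by force
  qed (use h hh in auto)
  ultimately have "linear_iso (cells (l \<circ> ?s)) (cells l) ?h" by (simp add: linear_iso_def)
  from linear_iso_comp[OF this phi(1)]
  have "linear_iso (cells (l \<circ> ?s)) {..<n} (\<lambda>z. \<phi> (?h z))" .
  moreover have "T (\<phi> (?h z)) = \<phi> (?h (shift z))" if "z \<in> vecs (cells (l \<circ> ?s))" for z
  proof -
    have "?h (shift z) = shift (?h z)" by auto
    then show ?thesis using phi(2)[OF h[OF that]] by simp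
  qed
  ultimately show ?thesis unfolding has_jordan_type_def by blast
qed

section \<open>Bordering a nilpotent operator\<close>

text \<open>This is the operator of a matrix bordered by the column \<open>v\<close> and a zero last
  row, if \<open>T\<close> is that of the matrix itself.\<close>

definition extend_op :: "nat \<Rightarrow> ((nat \<Rightarrow> 'a) \<Rightarrow> nat \<Rightarrow> 'a) \<Rightarrow> (nat \<Rightarrow> 'a) \<Rightarrow> (nat \<Rightarrow> 'a) \<Rightarrow> nat \<Rightarrow> 'a" where
  "extend_op n T v x = (\<lambda>i. if i < n then T (x(n := \<zero>)) i \<oplus> x n \<otimes> v i else \<zero>)"

text \<open>
  Subtracting a preimage of \<open>w\<close> from the new basis vector \<open>e\<close> leaves only the top coordinates of
  \<open>w\<close>. Row \<open>r\<close> is a longest row with a nonzero top coordinate, and its chain is replaced by the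
  chain of length \<open>l r + 1\<close> generated by \<open>e\<close>.
\<close>

lemma has_jordan_type_extend_pivot:
  assumes phi: "linear_iso (cells l) {..<n} \<phi>"
    and inter: "\<And>z. z \<in> vecs (cells l) \<Longrightarrow> T (\<phi> z) = \<phi> (shift z)"
    and fin: "finite (cells l)" "card (cells l) = n"
    and w: "w \<in> vecs (cells l)"
    and long: "\<And>i. l r < l i \<Longrightarrow> w (i, l i - 1) = \<zero>"
    and pivot: "0 < l r \<Longrightarrow> w (r, l r - 1) \<noteq> \<zero>"
  shows "has_jordan_type (Suc n) (extend_op n T (\<phi> w)) (l(r := Suc (l r)))"
proof -
  define l' where "l' = l(r := Suc (l r))"
  define m where "m = l r"
  \<comment> \<open>The map \<open>f\<close> writes a new basis in old coordinates. Cut to the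
    diagram, \<open>s\<close> is a preimage of \<open>w\<close> up to its top coordinates
    \<open>c\<close>, and \<open>d\<close> discards the old chain of row \<open>r\<close>. Box
    \<open>(r, m)\<close> becomes the new basis vector minus \<open>s\<close>, and
    \<open>(r, p)\<close> with \<open>p < m\<close> becomes the combination, with weights
    \<open>c i\<close>, of those boxes \<open>(i, p + l i - m)\<close> that exist.\<close>
  define d where "d i = (if i = r then \<zero> else \<one>)" for i
  define c where "c i = (if l i = 0 \<or> m < l i then \<zero> else w (i, l i - 1))" for i
  define s where "s i j = (if j = 0 then \<zero> else w (i, j - 1))" for i j
  \<comment> \<open>The difference \<open>j + m - l i\<close> is exact wherever it matters, because
    \<open>c i\<close> is zero for \<open>m < l i\<close>.\<close>
  define f where "f z = (\<lambda>(i, j). if j < l i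
     then d i \<otimes> z (i, j) \<oplus> c i \<otimes> z (r, j + m - l i) \<oplus> \<ominus> (z (r, m) \<otimes> s i j) else \<zero>)" for z
  define g where "g z = (\<phi> (f z))(n := z (r, m))" for z
  have cl [simp]: "d i \<in> carrier K" "c i \<in> carrier K" "s i j \<in> carrier K" for i j
    using vecs_carrier[OF w] by (auto simp: d_def c_def s_def)
  have lin: "linear_map (cells l) {..<n} \<phi>" using phi by (simp add: linear_iso_def)
  have fv: "f z \<in> vecs (cells l)" if z: "z \<in> vecs (cells l')" for z
    using vecs_carrier[OF z] by (intro vecsI) (auto simp: f_def)
  have "linear_map (cells l') (cells l) f"
  proof (rule linear_mapI)
    fix x y and p :: "nat \<times> nat" assume xy: "x \<in> vecs (cells l')" "y \<in> vecs (cells l')"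
    note [simp] = xy[THEN vecs_carrier]
    obtain i j where p: "p = (i, j)" by (cases p)
    let ?k = "(r, j + m - l i)"
    have "d i \<otimes> (x p \<oplus> y p) \<oplus> c i \<otimes> (x ?k \<oplus> y ?k) \<oplus> \<ominus> ((x (r, m) \<oplus> y (r, m)) \<otimes> s i j)
      = (d i \<otimes> x p \<oplus> c i \<otimes> x ?k \<oplus> \<ominus> (x (r, m) \<otimes> s i j))
        \<oplus> (d i \<otimes> y p \<oplus> c i \<otimes> y ?k \<oplus> \<ominus> (y (r, m) \<otimes> s i j))"
      using cl xy[THEN vecs_carrier, of p] xy[THEN vecs_carrier, of ?k] xy[THEN vecs_carrier, of "(r, m)"]
      by algebra
    then show "f (vadd x y) p = f x p \<oplus> f y p" by (simp add: f_def vadd_def p)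
  next
    fix a x and p :: "nat \<times> nat" assume a: "a \<in> carrier K" and x: "x \<in> vecs (cells l')"
    obtain i j where p: "p = (i, j)" by (cases p)
    let ?k = "(r, j + m - l i)"
    have "d i \<otimes> (a \<otimes> x p) \<oplus> c i \<otimes> (a \<otimes> x ?k) \<oplus> \<ominus> ((a \<otimes> x (r, m)) \<otimes> s i j)
      = a \<otimes> (d i \<otimes> x p \<oplus> c i \<otimes> x ?k \<oplus> \<ominus> (x (r, m) \<otimes> s i j))"
      using cl a vecs_carrier[OF x, of p] vecs_carrier[OF x, of ?k] vecs_carrier[OF x, of "(r, m)"]
      by algebra
    then show "f (vscale a x) p = a \<otimes> f x p" using a by (simp add: f_def vscale_def p)
  qed (rule fv)
  from linear_map_comp[OF this lin] have linf: "linear_map (cells l') {..<n} (\<lambda>z. \<phi> (f z))" .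
  have "linear_map (cells l') {..<Suc n} g"
  proof (rule linear_mapI)
    show "g z \<in> vecs {..<Suc n}" if z: "z \<in> vecs (cells l')" for z
      using linear_mapD(1)[OF linf z] vecs_carrier[OF z] by (auto simp: g_def vecs_def)
    show "g (vadd x y) i = g x i \<oplus> g y i" if "x \<in> vecs (cells l')" "y \<in> vecs (cells l')" for x y i
      using linear_mapD(2)[OF linf that] by (simp add: g_def vadd_def)
    show "g (vscale a x) i = a \<otimes> g x i" if "a \<in> carrier K" "x \<in> vecs (cells l')" for a x i
      using linear_mapD(3)[OF linf that(2,1)] by (simp add: g_def vscale_def)
  qed
  moreover have "z = vzero" if z: "z \<in> vecs (cells l')" and g0: "g z = vzero" for z
  proof -
    have zm: "z (r, m) = \<zero>" using fun_cong[OF g0, of n] by (simp add: g_def)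
    have "\<phi> (f z) i = \<zero>" for i
      using fun_cong[OF g0, of i] vecs_outside[OF linear_mapD(1)[OF linf z], of n]
      by (cases "i = n") (auto simp: g_def)
    then have "\<phi> (f z) = \<phi> vzero" using linear_map_zero[OF lin] by auto
    then have "f z = vzero" using phi fv[OF z]
      by (auto simp: linear_iso_def bij_betw_def dest: inj_onD)
    then have fz: "f z (i, j) = \<zero>" for i j by simp
    have f0: "d i \<otimes> z (i, j) \<oplus> c i \<otimes> z (r, j + m - l i) = \<zero>" if "j < l i" for i j
      using fz[of i j] that zm vecs_carrier[OF z] by (simp add: f_def)
    \<comment> \<open>Row \<open>r\<close> of \<open>f z\<close> reduces to \<open>c r\<close> times
      row \<open>r\<close> of \<open>z\<close>, as \<open>d r\<close> and \<open>z (r, m)\<close>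
      are zero. The pivot condition makes \<open>c r\<close> nonzero.\<close>
    have zr: "z (r, j) = \<zero>" for j
    proof (cases j m rule: linorder_cases)
      case less
      then have "c r \<otimes> z (r, j) = \<zero>" using f0[of j r] vecs_carrier[OF z] by (simp add: m_def d_def)
      moreover have "c r \<noteq> \<zero>" using pivot less by (simp add: c_def m_def)
      ultimately show ?thesis using integral vecs_carrier[OF z] cl(2) by blast
    next
      case greater
      then show ?thesis using vecs_outside[OF z] by (simp add: l'_def m_def)
    qed (use zm in simp)
    have "z (i, j) = \<zero>" for i j
    proof (cases "i = r")
      case True then show ?thesis using zr by simp
    next
      case False
      show ?thesis
      proof (cases "j < l i")
        case True
        then show ?thesis using f0[OF True] zr False vecs_carrier[OF z] by (simp add: d_def)
      next
        case not: False
        then show ?thesis using vecs_outside[OF z, of "(i, j)"] False by (simp add: l'_def)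
      qed
    qed
    then show ?thesis by (auto simp: fun_eq_iff)
  qed
  moreover have "finite (cells l')" "card (cells l') = Suc n"
    using fin cells_add_box[where l = l and r = r] by (simp_all add: l'_def)
  ultimately have "linear_iso (cells l') {..<Suc n} g" by (intro linear_iso_of_kernel) auto
  moreover have "extend_op n T (\<phi> w) (g z) = g (shift z)" if z: "z \<in> vecs (cells l')" for z
  proof -
    note zc = vecs_carrier[OF z]
    \<comment> \<open>These are the old coordinates of the image of \<open>g z\<close>. Inside a row
      the term with \<open>s\<close> cancels \<open>w\<close>; in the top box the remaining
      coordinate of \<open>w\<close> is matched by the term with \<open>c\<close>.\<close>
    let ?u = "vadd (shift (f z)) (vscale (z (r, m)) w)"
    have "?u (i, j) = f (shift z) (i, j)" for i j
    proof (cases "j < l i")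
      case False
      then show ?thesis using vecs_outside[OF w, of "(i, j)"] zc by (simp add: vadd_def vscale_def f_def)
    next
      case True
      have zm: "z (r, Suc m) = \<zero>" using vecs_outside[OF z] by (simp add: l'_def m_def)
      have w1: "w (i, j) \<in> carrier K" using vecs_carrier[OF w] .
      show ?thesis
      proof (cases "Suc j < l i")
        case True
        have "(A \<oplus> B \<oplus> \<ominus> (t \<otimes> w (i, j))) \<oplus> t \<otimes> w (i, j) = A \<oplus> B"
          if "A \<in> carrier K" "B \<in> carrier K" "t \<in> carrier K" for A B t
          using that w1 by algebra
        moreover have "Suc j + m - l i = Suc (j + m - l i) \<or> c i = \<zero>"
          by (auto simp: c_def)
        ultimately show ?thesis
          using True \<open>j < l i\<close> zc zm vecs_carrier[OF w] by (auto simp: vadd_def vscale_def f_def s_def)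
      next
        case False
        then have j: "l i = Suc j" using \<open>j < l i\<close> by simp
        \<comment> \<open>The box \<open>(i, Suc j)\<close> lies just past the end of row
          \<open>i\<close>. In the extended row \<open>r\<close> it does exist, but there
          \<open>d r\<close> is zero.\<close>
        have "d i \<otimes> z (i, Suc j) = \<zero>"
          using vecs_outside[OF z, of "(i, Suc j)"] j zc by (auto simp: d_def l'_def)
        moreover have "c i \<otimes> z (r, Suc (j + m - l i)) = z (r, m) \<otimes> w (i, j)"
        proof (cases "m < l i")
          case True
          then show ?thesis using long[of i] zc j by (simp add: c_def m_def)
        next
          case False
          then have "Suc (j + m - l i) = m" "c i = w (i, j)" using j by (auto simp: c_def)
          then show ?thesis using w1 zc by (simp add: m_comm)
        qed
        ultimately show ?thesis
          using j zc zm w1 by (simp add: vadd_def vscale_def f_def)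
      qed
    qed
    then have eq: "?u = f (shift z)" by (auto simp: fun_eq_iff)
    have "\<phi> ?u = vadd (T (\<phi> (f z))) (vscale (z (r, m)) (\<phi> w))"
      using linear_mapD(2)[OF lin, of "shift (f z)" "vscale (z (r, m)) w"]
        linear_mapD(3)[OF lin w zc[of "(r, m)"]] fv[OF z] inter[OF fv[OF z]] zc w by simp
    then have main: "\<phi> (f (shift z)) = vadd (T (\<phi> (f z))) (vscale (z (r, m)) (\<phi> w))"
      unfolding eq .
    have cut: "(g z)(n := \<zero>) = \<phi> (f z)"
      using vecs_outside[OF linear_mapD(1)[OF linf z], of n] by (auto simp: g_def)
    have gz: "g z n = z (r, m)" by (simp add: g_def)
    have "shift z (r, m) = \<zero>" using vecs_outside[OF z] by (simp add: l'_def m_def)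
    then have out: "g (shift z) i = \<zero>" if "\<not> i < n" for i
      using vecs_outside[OF linear_mapD(1)[OF linf shift_vecs[OF z]], of i] that by (simp add: g_def)
    show ?thesis
    proof
      fix i
      show "extend_op n T (\<phi> w) (g z) i = g (shift z) i"
      proof (cases "i < n")
        case True
        then have "g (shift z) i = \<phi> (f (shift z)) i" by (simp add: g_def)
        then show ?thesis using True unfolding extend_op_def cut gz main by (simp add: vadd_def vscale_def)
      qed (simp add: out extend_op_def)
    qed
  qed
  ultimately show ?thesis unfolding has_jordan_type_def l'_def by blast
qed

text \<open>The coordinates of the columns that put the new box into column \<open>m\<close>.\<close>

definition pivots :: "(nat \<Rightarrow> nat) \<Rightarrow> nat \<Rightarrow> (nat \<times> nat \<Rightarrow> 'a) set" where
  "pivots l m = {w \<in> vecs (cells l). (\<forall>i. m < l i \<longrightarrow> w (i, l i - 1) = \<zero>) \<and>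
     (0 < m \<longrightarrow> (\<exists>i. l i = m \<and> w (i, m - 1) \<noteq> \<zero>))}"

text \<open>The row \<open>p\<close> with the nonzero top coordinate may differ from
  \<open>r\<close> but has the same length, so row \<open>p\<close> is extended first and then
  swapped with row \<open>r\<close>.\<close>

lemma has_jordan_type_extend:
  assumes "linear_iso (cells l) {..<n} \<phi>"
    and "\<And>z. z \<in> vecs (cells l) \<Longrightarrow> T (\<phi> z) = \<phi> (shift z)"
    and "finite (cells l)" "card (cells l) = n"
    and w: "w \<in> pivots l (l r)"
  shows "has_jordan_type (Suc n) (extend_op n T (\<phi> w)) (l(r := Suc (l r)))"
proof -
  obtain p where p: "l p = l r" "0 < l r \<Longrightarrow> w (p, l p - 1) \<noteq> \<zero>"
    using w by (cases "l r = 0") (auto simp: pivots_def)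
  have "has_jordan_type (Suc n) (extend_op n T (\<phi> w)) (l(p := Suc (l p)))"
    using w p by (intro has_jordan_type_extend_pivot[OF assms(1-4)]) (auto simp: pivots_def)
  then have "has_jordan_type (Suc n) (extend_op n T (\<phi> w)) (l(p := Suc (l p)) \<circ> Transposition.transpose p r)"
    by (rule has_jordan_type_swap_rows)
  moreover have "l(p := Suc (l p)) \<circ> Transposition.transpose p r = l(r := Suc (l r))"
  proof
    fix i show "(l(p := Suc (l p)) \<circ> Transposition.transpose p r) i = (l(r := Suc (l r))) i"
    proof (cases "i = p \<or> i = r")
      case True
      then show ?thesis using p(1) by (cases "p = r") auto
    next
      case False
      then have "Transposition.transpose p r i = i" by (intro transpose_apply_other) auto
      then show ?thesis using False by simp
    qed
  qed
  ultimately show ?thesis by simp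
qed

text \<open>The box goes to the greatest length of a row in which \<open>w\<close> has a nonzero top
  coordinate, or to length zero if there is none. Choosing the first row of that length keeps the
  shape a partition.\<close>

lemma ex_pivot_row:
  assumes l: "is_partition n l" and w: "w \<in> vecs (cells l)"
  obtains r where "w \<in> pivots l (l r)" "is_partition (Suc n) (l(r := Suc (l r)))"
    "corner (l(r := Suc (l r))) r"
proof -
  define D where "D = {i. 0 < l i \<and> w (i, l i - 1) \<noteq> \<zero>}"
  have rows: "finite {i. 1 \<le> l i}" by (rule card_rows_le(1)[OF l]) simp
  have finD: "finite D" by (rule finite_subset[OF _ rows]) (auto simp: D_def)
  obtain m where m: "w \<in> pivots l m" "\<exists>i. l i = m"
  proof (cases "D = {}")
    case True
    \<comment> \<open>Only finitely many rows are nonempty, so an empty row can receive the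
      box.\<close>
    have "\<exists>i. i \<notin> {i. 1 \<le> l i}" using ex_new_if_finite[OF infinite_UNIV_nat rows] .
    then have "\<exists>i. l i = 0" by (auto simp: Suc_le_eq)
    moreover have "w (i, l i - 1) = \<zero>" if "0 < l i" for i
      using True that unfolding D_def by blast
    then have "w \<in> pivots l 0" using w by (simp add: pivots_def)
    ultimately show ?thesis using that by blast
  next
    case False
    define m where "m = Max (l ` D)"
    have "m \<in> l ` D" unfolding m_def using finD False by (intro Max_in) auto
    then obtain i where i: "i \<in> D" "l i = m" by auto
    have max: "l k \<le> m" if "k \<in> D" for k unfolding m_def using finD that by (intro Max_ge) auto
    have "w (k, l k - 1) = \<zero>" if "m < l k" for k
      using max[of k] that by (auto simp: D_def)
    then have "w \<in> pivots l m" using w i by (auto simp: pivots_def D_def)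
    then show ?thesis using that i by blast
  qed
  define r where "r = (LEAST i. l i = m)"
  have r: "l r = m" unfolding r_def using m(2) by (rule LeastI_ex)
  have anti: "i \<le> j \<Longrightarrow> l j \<le> l i" for i j using l by (simp add: is_partition_def antimonoD)
  have less: "Suc (l r) \<le> l i" if "i < r" for i
    using anti[of i r] that not_less_Least[of i "\<lambda>i. l i = m", folded r_def] r by auto
  have "antimono (l(r := Suc (l r)))"
    using less anti by (intro antimonoI) (auto intro: le_SucI)
  then have "is_partition (Suc n) (l(r := Suc (l r)))"
    using l cells_add_box[where l = l and r = r] by (simp add: is_partition_def)
  moreover have "corner (l(r := Suc (l r))) r" using anti[of r "Suc r"] by (simp add: corner_def)
  ultimately show ?thesis using that m(1) r by blast
qed

text \<open>With \<open>m = l r - 1\<close>, pivot vectors form the difference of two nested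
  coordinate subspaces, whose codimensions count the rows longer than \<open>m\<close> and those of
  length at least \<open>m\<close>. For \<open>m = 0\<close> only the larger subspace
  occurs.\<close>

lemma card_pivots:
  assumes l: "is_partition (Suc n) l" and r: "corner l r"
  shows "int (card (pivots (remove_box l r) (l r - 1))) = poly (box_poly n l r) (int (card (carrier K)))"
proof -
  define h where "h = remove_box l r"
  define m where "m = l r - 1"
  define q where "q = card (carrier K)"
  have h: "finite (cells h)" "card (cells h) = n"
    using is_partition_remove_box[OF l r] by (auto simp: is_partition_def h_def)
  \<comment> \<open>\<open>U S\<close> is the subspace on which the top coordinates of the rows in
    \<open>S\<close> vanish. Its codimension is \<open>card S\<close> if these rows are
    nonempty.\<close>
  define U where "U S = vecs (cells h - (\<lambda>i. (i, h i - 1)) ` S)" for S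
  have U_iff: "w \<in> U S \<longleftrightarrow> w \<in> vecs (cells h) \<and> (\<forall>i\<in>S. w (i, h i - 1) = \<zero>)" for S w
    by (auto simp: U_def vecs_def)
  have finU: "finite (U S)" for S unfolding U_def using h by (intro card_vecs(1)) auto
  have cardU: "card (U S) = q ^ (n - card S)" if "S \<subseteq> {i. 0 < h i}" for S
  proof -
    have sub: "(\<lambda>i. (i, h i - 1)) ` S \<subseteq> cells h" using that by auto
    moreover have "card ((\<lambda>i. (i, h i - 1)) ` S) = card S" by (rule card_image) (auto simp: inj_on_def)
    ultimately show ?thesis
      unfolding U_def using h card_vecs(2)[of "cells h - (\<lambda>i. (i, h i - 1)) ` S"]
      by (simp add: card_Diff_subset finite_subset q_def)
  qed
  have c1: "card (U {i. m < h i}) = q ^ (n - r)"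
  proof -
    have "{i. m < h i} = {..<r}" unfolding h_def m_def by (rule card_longer_rows[OF l r])
    moreover have "{i. m < h i} \<subseteq> {i. 0 < h i}" by auto
    ultimately show ?thesis using cardU[of "{..<r}"] by simp
  qed
  show ?thesis
  proof (cases "l r = 1")
    case True
    \<comment> \<open>Here \<open>m = 0\<close>, so the existence condition in \<open>pivots\<close>
      is void; this matches the zero case in \<open>box_poly\<close>.\<close>
    then have "pivots h m = U {i. m < h i}" by (auto simp: pivots_def U_iff m_def)
    then show ?thesis using c1 True by (simp add: box_poly_def poly_monom q_def h_def m_def)
  next
    case False
    then have m: "0 < m" using corner_pos[OF r] by (simp add: m_def)
    have "pivots h m = U {i. m < h i} - U {i. m \<le> h i}"
    proof (rule Set.set_eqI)
      fix w
      have "(\<forall>i. m \<le> h i \<longrightarrow> w (i, h i - 1) = \<zero>) \<longleftrightarrow>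
        (\<forall>i. m < h i \<longrightarrow> w (i, h i - 1) = \<zero>) \<and> (\<forall>i. h i = m \<longrightarrow> w (i, m - 1) = \<zero>)"
        (is "?L \<longleftrightarrow> ?R")
      proof
        assume L: ?L
        show ?R
        proof (intro conjI allI impI)
          fix i assume "h i = m"
          then show "w (i, m - 1) = \<zero>" using spec[OF L, of i] by simp
        qed (use L in simp)
      next
        assume R: ?R
        show ?L
        proof (intro allI impI)
          fix i assume "m \<le> h i"
          then consider "m < h i" | "h i = m" by linarith
          then show "w (i, h i - 1) = \<zero>" by cases (use R in simp_all)
        qed
      qed
      then show "w \<in> pivots h m \<longleftrightarrow> w \<in> U {i. m < h i} - U {i. m \<le> h i}"
        unfolding pivots_def Diff_iff U_iff mem_Collect_eq Ball_Collect subset_iff using m by blast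
    qed
    moreover have "U {i. m \<le> h i} \<subseteq> U {i. m < h i}" by (auto simp: U_iff)
    ultimately have "card (pivots h m) = card (U {i. m < h i}) - card (U {i. m \<le> h i})"
      "card (U {i. m \<le> h i}) \<le> card (U {i. m < h i})"
      using finU by (simp_all add: card_Diff_subset card_mono)
    moreover have "card (U {i. m \<le> h i}) = q ^ (n - card {i. m \<le> h i})"
      by (rule cardU) (use m in auto)
    ultimately show ?thesis using c1 False
      by (simp add: box_poly_def poly_monom of_nat_diff q_def h_def m_def)
  qed
qed

section \<open>Counting strictly upper triangular matrices\<close>

definition act :: "nat \<Rightarrow> 'a mat \<Rightarrow> (nat \<Rightarrow> 'a) \<Rightarrow> nat \<Rightarrow> 'a" where
  "act n A x = (\<lambda>i. if i < n then \<Oplus>k\<in>{..<n}. A $$ (i, k) \<otimes> x k else \<zero>)"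

definition border :: "nat \<Rightarrow> 'a mat \<Rightarrow> (nat \<Rightarrow> 'a) \<Rightarrow> 'a mat" where
  "border n B v = mat (Suc n) (Suc n)
     (\<lambda>(i, j). if i < n then if j < n then B $$ (i, j) else v i else \<zero>)"

text \<open>The type is expressed by coordinates and not by similarity to a Jordan matrix, because
  bordering is computed in coordinates. The link is \<open>similar_jordan_iff\<close>.\<close>

definition jordan_mats :: "nat \<Rightarrow> (nat \<Rightarrow> nat) \<Rightarrow> 'a mat set" where
  "jordan_mats n l = {A \<in> strictly_upper_mats K n. has_jordan_type n (act n A) l}"

lemma has_jordan_type_cong:
  assumes "\<And>x. x \<in> vecs {..<n} \<Longrightarrow> T x = T' x"
  shows "has_jordan_type n T l \<longleftrightarrow> has_jordan_type n T' l"
proof -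
  have "T (\<phi> z) = T' (\<phi> z)" if "linear_iso (cells l) {..<n} \<phi>" "z \<in> vecs (cells l)" for \<phi> z
  proof -
    have "linear_map (cells l) {..<n} \<phi>" using that(1) by (simp add: linear_iso_def)
    then show ?thesis using assms linear_mapD(1) that(2) by blast
  qed
  then show ?thesis unfolding has_jordan_type_def by (metis (no_types, lifting))
qed

lemma sq_mats_carrier:
  "A \<in> sq_mats K n \<Longrightarrow> i < n \<Longrightarrow> j < n \<Longrightarrow> A $$ (i, j) \<in> carrier K"
  by (simp add: sq_mats_def)

lemma strictly_upper_sq: "A \<in> strictly_upper_mats K n \<Longrightarrow> A \<in> sq_mats K n"
  by (simp add: strictly_upper_mats_def)

text \<open>Splitting off the last summand separates the old matrix from the new column, and the
  last row is zero.\<close>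

lemma act_border:
  assumes B: "B \<in> sq_mats K n" and v: "v \<in> vecs {..<n}" and x: "x \<in> vecs {..<Suc n}"
  shows "act (Suc n) (border n B v) x = extend_op n (act n B) v x"
proof
  fix i
  note [simp] = vecs_carrier[OF v] vecs_carrier[OF x] sq_mats_carrier[OF B]
  consider "i < n" | "i = n" | "n < i" by linarith
  then show "act (Suc n) (border n B v) x i = extend_op n (act n B) v x i"
  proof cases
    case 1
    have "(\<Oplus>k\<in>{..<Suc n}. border n B v $$ (i, k) \<otimes> x k)
        = border n B v $$ (i, n) \<otimes> x n \<oplus> (\<Oplus>k\<in>{..<n}. border n B v $$ (i, k) \<otimes> x k)"
      using 1 by (subst lessThan_Suc, subst finsum_insert) (auto simp: border_def)
    also have "(\<Oplus>k\<in>{..<n}. border n B v $$ (i, k) \<otimes> x k) = (\<Oplus>k\<in>{..<n}. B $$ (i, k) \<otimes> x k)"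
      using 1 by (intro finsum_cong') (auto simp: border_def)
    also have "\<dots> = (\<Oplus>k\<in>{..<n}. B $$ (i, k) \<otimes> (x(n := \<zero>)) k)"
      using 1 by (intro finsum_cong') auto
    finally show ?thesis
      using 1 by (simp add: act_def extend_op_def border_def a_comm m_comm finsum_closed Pi_def)
  next
    case 2
    have "(\<Oplus>k\<in>{..<Suc n}. border n B v $$ (n, k) \<otimes> x k) = (\<Oplus>k\<in>{..<Suc n}. \<zero>)"
      by (intro finsum_cong') (auto simp: border_def)
    then show ?thesis using 2 by (simp add: act_def extend_op_def)
  next
    case 3 then show ?thesis by (simp add: act_def extend_op_def)
  qed
qed

lemma has_jordan_type_border:
  assumes "B \<in> sq_mats K n" "v \<in> vecs {..<n}"
  shows "has_jordan_type (Suc n) (act (Suc n) (border n B v)) l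
    \<longleftrightarrow> has_jordan_type (Suc n) (extend_op n (act n B) v) l"
  by (rule has_jordan_type_cong) (rule act_border[OF assms])

lemma bij_betw_border:
  "bij_betw (\<lambda>(B, v). border n B v) (strictly_upper_mats K n \<times> vecs {..<n})
     (strictly_upper_mats K (Suc n))"
proof (rule bij_betw_byWitness[where f' = "\<lambda>A. (mat n n (\<lambda>p. A $$ p), \<lambda>i. if i < n then A $$ (i, n) else \<zero>)"])
  show "\<forall>p\<in>strictly_upper_mats K n \<times> vecs {..<n}. (mat n n (\<lambda>q. (case p of (B, v) \<Rightarrow> border n B v) $$ q),
      \<lambda>i. if i < n then (case p of (B, v) \<Rightarrow> border n B v) $$ (i, n) else \<zero>) = p"
    by (auto simp: border_def strictly_upper_mats_def sq_mats_def vecs_def fun_eq_iff intro!: eq_matI)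
  show "\<forall>A\<in>strictly_upper_mats K (Suc n). (case (mat n n (\<lambda>p. A $$ p),
      \<lambda>i. if i < n then A $$ (i, n) else \<zero>) of (B, v) \<Rightarrow> border n B v) = A"
    by (auto simp: border_def strictly_upper_mats_def sq_mats_def less_Suc_eq intro!: eq_matI)
  show "(\<lambda>(B, v). border n B v) ` (strictly_upper_mats K n \<times> vecs {..<n}) \<subseteq> strictly_upper_mats K (Suc n)"
    by (auto simp: border_def strictly_upper_mats_def sq_mats_def vecs_def)
  show "(\<lambda>A. (mat n n (\<lambda>p. A $$ p), \<lambda>i. if i < n then A $$ (i, n) else \<zero>)) ` strictly_upper_mats K (Suc n)
      \<subseteq> strictly_upper_mats K n \<times> vecs {..<n}"
    by (auto simp: strictly_upper_mats_def sq_mats_def vecs_def)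
qed

lemma strictly_upper_mats_0: "strictly_upper_mats K 0 = {mat 0 0 (\<lambda>_. \<zero>)}"
proof -
  have "A = mat 0 0 (\<lambda>_. \<zero>)" if "A \<in> carrier_mat 0 0" for A :: "'a mat"
    by (rule eq_matI) (use that in auto)
  then show ?thesis by (auto simp: strictly_upper_mats_def sq_mats_def)
qed

lemma finite_strictly_upper_mats: "finite (strictly_upper_mats K n)"
proof (induction n)
  case (Suc n)
  then have "finite (strictly_upper_mats K n \<times> vecs {..<n})" by (simp add: card_vecs(1))
  then show ?case using bij_betw_finite[OF bij_betw_border] by blast
qed (simp add: strictly_upper_mats_0)

lemma vecs_empty: "vecs {} = {vzero}"
  by (auto simp: vecs_def fun_eq_iff)

lemma has_jordan_type_0:
  assumes "cells l = {}"
  shows "has_jordan_type 0 (act 0 A) l"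
proof -
  have "linear_iso (cells l) {..<0::nat} (\<lambda>_. vzero)"
    using assms by (simp add: linear_iso_def bij_betw_def linear_map_def vecs_empty vadd_def vscale_def)
  then show ?thesis unfolding has_jordan_type_def by (force simp: act_def)
qed

text \<open>In the Jordan coordinates of \<open>B\<close> the column has a pivot row, which decides
  where the box is added.\<close>

lemma border_jordan_type:
  assumes B: "B \<in> strictly_upper_mats K n" and m: "is_partition n m" "has_jordan_type n (act n B) m"
    and v: "v \<in> vecs {..<n}"
  obtains r where "has_jordan_type (Suc n) (act (Suc n) (border n B v)) (m(r := Suc (m r)))"
    "is_partition (Suc n) (m(r := Suc (m r)))" "corner (m(r := Suc (m r))) r"
proof -
  obtain \<phi> where phi: "linear_iso (cells m) {..<n} \<phi>"
    "\<And>z. z \<in> vecs (cells m) \<Longrightarrow> act n B (\<phi> z) = \<phi> (shift z)"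
    using m by (auto simp: has_jordan_type_def)
  obtain w where w: "w \<in> vecs (cells m)" "v = \<phi> w"
    using phi(1) v by (auto simp: linear_iso_def bij_betw_def)
  obtain r where r: "w \<in> pivots m (m r)" "is_partition (Suc n) (m(r := Suc (m r)))"
    "corner (m(r := Suc (m r))) r"
    using ex_pivot_row[OF m(1) w(1)] by blast
  have "has_jordan_type (Suc n) (extend_op n (act n B) v) (m(r := Suc (m r)))"
    unfolding w(2) using m(1) r(1) by (intro has_jordan_type_extend[OF phi]) (auto simp: is_partition_def)
  then show ?thesis
    using that r has_jordan_type_border[OF strictly_upper_sq[OF B] v] by blast
qed

text \<open>The matrix is rebuilt column by column, each column adding one box to the type.\<close>

lemma ex_jordan_type:
  assumes "A \<in> strictly_upper_mats K n"
  shows "\<exists>l. is_partition n l \<and> has_jordan_type n (act n A) l"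
  using assms
proof (induction n arbitrary: A)
  case 0
  have "cells (\<lambda>_. 0) = {}" by auto
  then show ?case using has_jordan_type_0 by (intro exI[of _ "\<lambda>_. 0"]) (auto simp: is_partition_def monotone_def)
next
  case (Suc n)
  obtain B v where Bv: "B \<in> strictly_upper_mats K n" "v \<in> vecs {..<n}" "A = border n B v"
    using Suc.prems bij_betw_border[of n] by (force simp: bij_betw_def)
  then show ?case using Suc.IH[OF Bv(1)] border_jordan_type by metis
qed

text \<open>Jordan coordinates of \<open>B\<close> turn admissible columns into pivot vectors. Since
  every column yields some type, uniqueness of the type excludes all other columns.\<close>

lemma card_good_columns:
  assumes l: "is_partition (Suc n) l" and r: "corner l r" and B: "B \<in> jordan_mats n (remove_box l r)"
  shows "card {v \<in> vecs {..<n}. has_jordan_type (Suc n) (act (Suc n) (border n B v)) l}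
    = card (pivots (remove_box l r) (l r - 1))"
proof -
  define m where "m = remove_box l r"
  have pos: "0 < l r" using r by (rule corner_pos)
  have lm: "l = m(r := Suc (m r))" using pos by (auto simp: m_def)
  have m: "is_partition n m" unfolding m_def by (rule is_partition_remove_box[OF l r])
  have fin: "finite (cells m)" "card (cells m) = n" using m by (auto simp: is_partition_def)
  have B': "B \<in> sq_mats K n" using B strictly_upper_sq by (simp add: jordan_mats_def)
  obtain \<phi> where phi: "linear_iso (cells m) {..<n} \<phi>"
    "\<And>z. z \<in> vecs (cells m) \<Longrightarrow> act n B (\<phi> z) = \<phi> (shift z)"
    using B by (auto simp: jordan_mats_def has_jordan_type_def m_def)
  have bij: "bij_betw \<phi> (vecs (cells m)) (vecs {..<n})" using phi by (simp add: linear_iso_def)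
  have "has_jordan_type (Suc n) (act (Suc n) (border n B (\<phi> w))) l \<longleftrightarrow> w \<in> pivots m (m r)"
    if w: "w \<in> vecs (cells m)" for w
  proof -
    have "\<phi> w \<in> vecs {..<n}" using bij w by (rule bij_betwE[rule_format])
    note cong = has_jordan_type_border[OF B' this]
    show ?thesis
    proof
      assume jt: "has_jordan_type (Suc n) (act (Suc n) (border n B (\<phi> w))) l"
      obtain s where s: "w \<in> pivots m (m s)" "is_partition (Suc n) (m(s := Suc (m s)))"
        using ex_pivot_row[OF m w] by blast
      have "has_jordan_type (Suc n) (act (Suc n) (border n B (\<phi> w))) (m(s := Suc (m s)))"
        unfolding cong by (rule has_jordan_type_extend[OF phi fin s(1)])
      then have "l = m(s := Suc (m s))" using jordan_type_unique jt l s(2) by blast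
      then have "m(r := Suc (m r)) = m(s := Suc (m s))" using lm by simp
      then have "s = r" by (metis fun_upd_apply n_not_Suc_n)
      then show "w \<in> pivots m (m r)" using s by simp
    next
      assume piv: "w \<in> pivots m (m r)"
      have "has_jordan_type (Suc n) (extend_op n (act n B) (\<phi> w)) (m(r := Suc (m r)))"
        by (rule has_jordan_type_extend[OF phi fin piv])
      then show "has_jordan_type (Suc n) (act (Suc n) (border n B (\<phi> w))) l"
        unfolding cong using lm by simp
    qed
  qed
  then have "bij_betw \<phi> {w \<in> vecs (cells m). w \<in> pivots m (m r)}
      {v \<in> vecs {..<n}. has_jordan_type (Suc n) (act (Suc n) (border n B v)) l}"
    using bij by (intro bij_betw_Collect) auto
  moreover have "{w \<in> vecs (cells m). w \<in> pivots m (m r)} = pivots m (m r)"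
    by (auto simp: pivots_def)
  ultimately show ?thesis using bij_betw_same_card by (fastforce simp: m_def)
qed

text \<open>Matrices of type \<open>l\<close> are sorted by the type of their leading block, which
  is \<open>l\<close> without one corner box. All blocks of one type admit equally many
  columns.\<close>

lemma card_jordan_mats:
  assumes "is_partition n l"
  shows "int (card (jordan_mats n l)) = poly (jpoly n l) (int (card (carrier K)))"
  using assms
proof (induction n arbitrary: l)
  case 0
  then have "cells l = {}" by (auto simp: is_partition_def)
  then have "jordan_mats 0 l = {mat 0 0 (\<lambda>_. \<zero>)}"
    using has_jordan_type_0 by (auto simp: jordan_mats_def strictly_upper_mats_0)
  then show ?case by simp
next
  case (Suc n)
  define C where "C B = {v \<in> vecs {..<n}. has_jordan_type (Suc n) (act (Suc n) (border n B v)) l}" for B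
  define S where "S r = (SIGMA B:jordan_mats n (remove_box l r). C B)" for r
  let ?b = "\<lambda>(B, v). border n B v"
  have sub: "(\<Union>r\<in>{r. corner l r}. S r) \<subseteq> strictly_upper_mats K n \<times> vecs {..<n}"
    by (auto simp: S_def C_def jordan_mats_def)
  have "jordan_mats (Suc n) l = ?b ` (\<Union>r\<in>{r. corner l r}. S r)"
  proof (intro equalityI subsetI)
    fix A assume A: "A \<in> jordan_mats (Suc n) l"
    then obtain B v where Bv: "B \<in> strictly_upper_mats K n" "v \<in> vecs {..<n}" "A = border n B v"
      using bij_betw_border[of n] by (force simp: bij_betw_def jordan_mats_def)
    obtain m where m: "is_partition n m" "has_jordan_type n (act n B) m"
      using ex_jordan_type[OF Bv(1)] by blast
    obtain r where r: "has_jordan_type (Suc n) (act (Suc n) A) (m(r := Suc (m r)))"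
      "is_partition (Suc n) (m(r := Suc (m r)))" "corner (m(r := Suc (m r))) r"
      using border_jordan_type[OF Bv(1) m Bv(2)] Bv(3) by blast
    have jt: "has_jordan_type (Suc n) (act (Suc n) A) l" using A by (simp add: jordan_mats_def)
    have l: "l = m(r := Suc (m r))" by (rule jordan_type_unique[OF jt r(1) Suc.prems r(2)])
    then have "remove_box l r = m" by auto
    then have "(B, v) \<in> S r" using Bv m jt by (simp add: S_def C_def jordan_mats_def)
    then show "A \<in> ?b ` (\<Union>r\<in>{r. corner l r}. S r)" using Bv(3) r(3) l by force
  next
    fix A assume "A \<in> ?b ` (\<Union>r\<in>{r. corner l r}. S r)"
    then obtain p where p: "p \<in> (\<Union>r\<in>{r. corner l r}. S r)" "A = ?b p" by blast
    then have "A \<in> strictly_upper_mats K (Suc n)" using sub bij_betw_border[of n] by (auto simp: bij_betw_def)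
    then show "A \<in> jordan_mats (Suc n) l" using p by (auto simp: jordan_mats_def S_def C_def)
  qed
  moreover have "inj_on ?b (\<Union>r\<in>{r. corner l r}. S r)"
    using bij_betw_border[of n] sub inj_on_subset by (auto simp: bij_betw_def)
  ultimately have "card (jordan_mats (Suc n) l) = card (\<Union>r\<in>{r. corner l r}. S r)"
    by (simp add: card_image)
  also have "\<dots> = (\<Sum>r | corner l r. card (S r))"
  proof (rule card_UN_disjoint)
    show "finite {r. corner l r}" by (rule finite_corners[OF Suc.prems])
    have "finite (strictly_upper_mats K n \<times> vecs {..<n})"
      by (simp add: card_vecs(1) finite_strictly_upper_mats)
    then have "finite (\<Union>r\<in>{r. corner l r}. S r)" by (rule finite_subset[OF sub])
    then show "\<forall>r\<in>{r. corner l r}. finite (S r)" by (meson UN_upper finite_subset)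
    show "\<forall>r\<in>{r. corner l r}. \<forall>s\<in>{r. corner l r}. r \<noteq> s \<longrightarrow> S r \<inter> S s = {}"
    proof (clarify, rule equals0I)
      \<comment> \<open>A block has only one Jordan type, so it cannot belong to two
        corners.\<close>
      fix r s p assume rs: "corner l r" "corner l s" "r \<noteq> s" and "p \<in> S r \<inter> S s"
      then have "has_jordan_type n (act n (fst p)) (remove_box l r)"
        "has_jordan_type n (act n (fst p)) (remove_box l s)"
        by (auto simp: S_def jordan_mats_def)
      then have "remove_box l r = remove_box l s"
        using jordan_type_unique is_partition_remove_box[OF Suc.prems] rs(1,2) by blast
      then have "remove_box l r r = remove_box l s r" by (rule fun_cong)
      then show False using rs corner_pos[OF rs(1)] by simp
    qed
  qed
  finally have "int (card (jordan_mats (Suc n) l)) = (\<Sum>r | corner l r. int (card (S r)))" by simp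
  also have "\<dots> = (\<Sum>r | corner l r. poly (box_poly n l r * jpoly n (remove_box l r)) (int (card (carrier K))))"
  proof (rule sum.cong)
    fix r assume "r \<in> {r. corner l r}"
    then have r: "corner l r" by simp
    have "finite (jordan_mats n (remove_box l r))"
      using finite_strictly_upper_mats by (simp add: jordan_mats_def)
    moreover have "finite (C B)" for B by (simp add: C_def card_vecs(1))
    ultimately have "card (S r) = (\<Sum>B\<in>jordan_mats n (remove_box l r). card (C B))"
      unfolding S_def by (intro card_SigmaI) auto
    also have "\<dots> = (\<Sum>B\<in>jordan_mats n (remove_box l r). card (pivots (remove_box l r) (l r - 1)))"
      unfolding C_def by (intro sum.cong card_good_columns[OF Suc.prems r] refl)
    finally have "int (card (S r)) = int (card (jordan_mats n (remove_box l r)))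
        * int (card (pivots (remove_box l r) (l r - 1)))" by simp
    then show "int (card (S r)) = poly (box_poly n l r * jpoly n (remove_box l r)) (int (card (carrier K)))"
      unfolding card_pivots[OF Suc.prems r] Suc.IH[OF is_partition_remove_box[OF Suc.prems r]] by simp
  qed simp
  finally show ?case by (simp add: poly_sum)
qed

section \<open>Similarity of matrices\<close>

definition basis_vec :: "nat \<Rightarrow> nat \<Rightarrow> 'a" where
  "basis_vec k = (\<lambda>i. if i = k then \<one> else \<zero>)"

lemma basis_vec_vecs: "k < n \<Longrightarrow> basis_vec k \<in> vecs {..<n}"
  by (auto simp: basis_vec_def vecs_def)

lemma act_summand:
  "A \<in> sq_mats K n \<Longrightarrow> x \<in> vecs J \<Longrightarrow> i < n \<Longrightarrow> (\<lambda>k. A $$ (i, k) \<otimes> x k) \<in> {..<n} \<rightarrow> carrier K"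
  by (auto intro: sq_mats_carrier vecs_carrier)

lemma act_vecs: "A \<in> sq_mats K n \<Longrightarrow> x \<in> vecs J \<Longrightarrow> act n A x \<in> vecs {..<n}"
  by (rule vecsI) (simp_all add: act_def finsum_closed act_summand)

lemma linear_map_act:
  assumes A: "A \<in> sq_mats K n"
  shows "linear_map {..<n} {..<n} (act n A)"
proof (rule linear_mapI)
  show "act n A x \<in> vecs {..<n}" if "x \<in> vecs {..<n}" for x
    using act_vecs[OF A that] .
  fix x i assume x: "x \<in> vecs {..<n}"
  note cl [simp] = sq_mats_carrier[OF A] vecs_carrier[OF x]
  show "act n A (vadd x y) i = act n A x i \<oplus> act n A y i" if y: "y \<in> vecs {..<n}" for y
  proof (cases "i < n")
    case True
    have "(\<Oplus>k\<in>{..<n}. A $$ (i, k) \<otimes> (x k \<oplus> y k))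
        = (\<Oplus>k\<in>{..<n}. A $$ (i, k) \<otimes> x k \<oplus> A $$ (i, k) \<otimes> y k)"
      using True vecs_carrier[OF y] by (intro finsum_cong') (auto simp: r_distr)
    also have "\<dots> = (\<Oplus>k\<in>{..<n}. A $$ (i, k) \<otimes> x k) \<oplus> (\<Oplus>k\<in>{..<n}. A $$ (i, k) \<otimes> y k)"
      by (rule finsum_addf) (use act_summand[OF A] x y True in auto)
    finally show ?thesis using True by (simp add: act_def vadd_def)
  qed (simp add: act_def)
  show "act n A (vscale a x) i = a \<otimes> act n A x i" if a: "a \<in> carrier K" for a
  proof (cases "i < n")
    case True
    have "(\<Oplus>k\<in>{..<n}. A $$ (i, k) \<otimes> (a \<otimes> x k)) = (\<Oplus>k\<in>{..<n}. a \<otimes> (A $$ (i, k) \<otimes> x k))"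
      using True a by (intro finsum_cong') (auto simp: m_lcomm)
    also have "\<dots> = a \<otimes> (\<Oplus>k\<in>{..<n}. A $$ (i, k) \<otimes> x k)"
      by (rule finsum_rdistr[symmetric]) (use a act_summand[OF A x] True in auto)
    finally show ?thesis using True by (simp add: act_def vscale_def)
  qed (simp add: act_def a)
qed

lemma mult_mat_over_sq:
  assumes "A \<in> sq_mats K n" "B \<in> sq_mats K n"
  shows "mult_mat_over K A B \<in> sq_mats K n"
  using assms by (auto simp: sq_mats_def mult_mat_over_def intro!: finsum_closed)

lemma one_mat_over_sq: "one_mat_over K n \<in> sq_mats K n"
  by (auto simp: sq_mats_def one_mat_over_def)

lemma act_mult:
  assumes A: "A \<in> sq_mats K n" and B: "B \<in> sq_mats K n" and x: "x \<in> vecs {..<n}"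
  shows "act n (mult_mat_over K A B) x = act n A (act n B x)"
proof
  fix i
  note cl [simp] = sq_mats_carrier[OF A] sq_mats_carrier[OF B] vecs_carrier[OF x]
  show "act n (mult_mat_over K A B) x i = act n A (act n B x) i"
  proof (cases "i < n")
    case True
    have dims: "dim_row A = n" "dim_col A = n" "dim_col B = n"
      using A B by (auto simp: sq_mats_def)
    have "(\<Oplus>k\<in>{..<n}. mult_mat_over K A B $$ (i, k) \<otimes> x k)
        = (\<Oplus>k\<in>{..<n}. \<Oplus>j\<in>{..<n}. A $$ (i, j) \<otimes> B $$ (j, k) \<otimes> x k)"
    proof (rule finsum_cong')
      fix k assume "k \<in> {..<n}"
      then show "mult_mat_over K A B $$ (i, k) \<otimes> x k = (\<Oplus>j\<in>{..<n}. A $$ (i, j) \<otimes> B $$ (j, k) \<otimes> x k)"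
        using True dims by (simp add: mult_mat_over_def finsum_ldistr Pi_def)
    qed (use True in \<open>auto intro!: finsum_closed\<close>)
    also have "\<dots> = (\<Oplus>j\<in>{..<n}. \<Oplus>k\<in>{..<n}. A $$ (i, j) \<otimes> B $$ (j, k) \<otimes> x k)"
      using True by (intro finsum_finsum_swap) auto
    also have "\<dots> = (\<Oplus>j\<in>{..<n}. A $$ (i, j) \<otimes> act n B x j)"
    proof (rule finsum_cong')
      fix j assume j: "j \<in> {..<n}"
      have "(\<Oplus>k\<in>{..<n}. A $$ (i, j) \<otimes> B $$ (j, k) \<otimes> x k)
          = (\<Oplus>k\<in>{..<n}. A $$ (i, j) \<otimes> (B $$ (j, k) \<otimes> x k))"
        using True j by (intro finsum_cong') (auto simp: m_assoc)
      also have "\<dots> = A $$ (i, j) \<otimes> (\<Oplus>k\<in>{..<n}. B $$ (j, k) \<otimes> x k)"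
        using True j by (intro finsum_rdistr[symmetric]) auto
      finally show "(\<Oplus>k\<in>{..<n}. A $$ (i, j) \<otimes> B $$ (j, k) \<otimes> x k) = A $$ (i, j) \<otimes> act n B x j"
        using j by (simp add: act_def)
    qed (use True vecs_carrier[OF act_vecs[OF B x]] in auto)
    finally show ?thesis using True by (simp add: act_def)
  qed (simp add: act_def)
qed

section \<open>Matrices and linear maps determine each other\<close>

lemma finsum_lessThan_single:
  fixes p n :: nat
  assumes "p < n" "\<And>k. k < n \<Longrightarrow> f k \<in> carrier K" "\<And>k. k < n \<Longrightarrow> k \<noteq> p \<Longrightarrow> f k = \<zero>"
  shows "(\<Oplus>k\<in>{..<n}. f k) = f p"
proof -
  have "(\<Oplus>k\<in>{..<n}. f k) = (\<Oplus>k\<in>{..<n}. if p = k then f k else \<zero>)"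
    using assms by (intro finsum_cong') auto
  also have "\<dots> = f p" using assms by (intro add.finprod_singleton) auto
  finally show ?thesis .
qed

lemma act_one: "x \<in> vecs {..<n} \<Longrightarrow> act n (one_mat_over K n) x = x"
proof
  fix i assume x: "x \<in> vecs {..<n}"
  show "act n (one_mat_over K n) x i = x i"
  proof (cases "i < n")
    case True
    then have "(\<Oplus>k\<in>{..<n}. one_mat_over K n $$ (i, k) \<otimes> x k) = one_mat_over K n $$ (i, i) \<otimes> x i"
      using vecs_carrier[OF x] by (intro finsum_lessThan_single) (auto simp: one_mat_over_def)
    then show ?thesis using True vecs_carrier[OF x] by (simp add: act_def one_mat_over_def)
  qed (use vecs_outside[OF x] in \<open>simp add: act_def\<close>)
qed

lemma act_basis_vec:
  assumes A: "A \<in> sq_mats K n" and "i < n" "k < n"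
  shows "act n A (basis_vec k) i = A $$ (i, k)"
proof -
  have "(\<Oplus>j\<in>{..<n}. A $$ (i, j) \<otimes> basis_vec k j) = A $$ (i, k) \<otimes> basis_vec k k"
    using assms sq_mats_carrier[OF A] by (intro finsum_lessThan_single) (auto simp: basis_vec_def)
  then show ?thesis using assms sq_mats_carrier[OF A] by (simp add: act_def basis_vec_def)
qed

lemma act_inject:
  assumes A: "A \<in> sq_mats K n" and B: "B \<in> sq_mats K n"
    and eq: "\<And>x. x \<in> vecs {..<n} \<Longrightarrow> act n A x = act n B x"
  shows "A = B"
proof (rule eq_matI)
  show "dim_row A = dim_row B" "dim_col A = dim_col B" using A B by (auto simp: sq_mats_def)
  fix i j assume "i < dim_row B" "j < dim_col B"
  then have ij: "i < n" "j < n" using B by (auto simp: sq_mats_def)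
  then show "A $$ (i, j) = B $$ (i, j)"
    using act_basis_vec[OF A ij] act_basis_vec[OF B ij] eq[OF basis_vec_vecs[OF ij(2)]] by simp
qed

lemma ex_act_of_linear_map:
  assumes f: "linear_map {..<n} {..<n} f"
  obtains P where "P \<in> sq_mats K n" "\<And>x. x \<in> vecs {..<n} \<Longrightarrow> act n P x = f x"
proof -
  define P where "P = mat n n (\<lambda>(i, k). f (basis_vec k) i)"
  have fu: "f (basis_vec k) \<in> vecs {..<n}" if "k < n" for k
    using linear_mapD(1)[OF f] basis_vec_vecs that by blast
  \<comment> \<open>Induction on the support of \<open>x\<close>, splitting off the last coordinate
    by linearity; the case \<open>m = n\<close> is the matrix product.\<close>
  have sum: "(\<Oplus>k\<in>{..<m}. f (basis_vec k) i \<otimes> x k) = f x i"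
    if "m \<le> n" "x \<in> vecs {..<m}" for m x i
    using that
  proof (induction m arbitrary: x)
    case 0
    then have "x = vzero" by (simp add: vecs_empty)
    then show ?case using linear_map_zero[OF f] by simp
  next
    case (Suc m)
    note x = vecs_carrier[OF Suc.prems(2)]
    let ?y = "x(m := \<zero>)"
    have y: "?y \<in> vecs {..<m}" using Suc.prems(2) by (auto simp: vecs_def less_Suc_eq)
    then have yn: "?y \<in> vecs {..<n}"
      by (intro vecsI vecs_carrier[OF y] vecs_outside[OF y]) (use Suc.prems(1) in auto)
    have un: "basis_vec m \<in> vecs {..<n}" using Suc.prems(1) by (intro basis_vec_vecs) simp
    have fm: "f (basis_vec k) i \<in> carrier K" if "k < Suc m" for k
      using vecs_carrier[OF fu] that Suc.prems(1) by simp
    have "x = vadd ?y (vscale (x m) (basis_vec m))"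
      using x by (auto simp: vadd_def vscale_def basis_vec_def)
    then have "f x = vadd (f ?y) (vscale (x m) (f (basis_vec m)))"
      using linear_mapD(2)[OF f yn, of "vscale (x m) (basis_vec m)"] linear_mapD(3)[OF f un x] un x
      by simp
    then have "f x i = f ?y i \<oplus> x m \<otimes> f (basis_vec m) i" by (simp add: vadd_def vscale_def)
    moreover have "f ?y i = (\<Oplus>k\<in>{..<m}. f (basis_vec k) i \<otimes> x k)"
    proof -
      have "(\<Oplus>k\<in>{..<m}. f (basis_vec k) i \<otimes> ?y k) = f ?y i"
        using Suc.prems(1) by (intro Suc.IH y) simp
      moreover have "(\<Oplus>k\<in>{..<m}. f (basis_vec k) i \<otimes> ?y k) = (\<Oplus>k\<in>{..<m}. f (basis_vec k) i \<otimes> x k)"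
        using fm x by (intro finsum_cong') auto
      ultimately show ?thesis by simp
    qed
    moreover have "(\<Oplus>k\<in>{..<Suc m}. f (basis_vec k) i \<otimes> x k)
        = f (basis_vec m) i \<otimes> x m \<oplus> (\<Oplus>k\<in>{..<m}. f (basis_vec k) i \<otimes> x k)"
      using fm x by (subst lessThan_Suc, subst finsum_insert) auto
    ultimately show ?case using fm x by (simp add: a_comm m_comm finsum_closed Pi_def)
  qed
  have P: "P \<in> sq_mats K n" using vecs_carrier[OF fu] by (auto simp: P_def sq_mats_def)
  have "act n P x = f x" if x: "x \<in> vecs {..<n}" for x
  proof
    fix i
    show "act n P x i = f x i"
    proof (cases "i < n")
      case True
      have "(\<Oplus>k\<in>{..<n}. P $$ (i, k) \<otimes> x k) = (\<Oplus>k\<in>{..<n}. f (basis_vec k) i \<otimes> x k)"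
        using True vecs_carrier[OF fu] vecs_carrier[OF x] by (intro finsum_cong') (auto simp: P_def)
      then show ?thesis using True sum[OF _ x] by (simp add: act_def)
    next
      case False
      then show ?thesis using vecs_outside[OF linear_mapD(1)[OF f x]] by (simp add: act_def)
    qed
  qed
  then show ?thesis using that P by blast
qed

text \<open>The conjugating matrix represents \<open>\<phi>\<close> and its inverse matrix
  represents the inverse map. The conjugation equation then says that \<open>\<phi>\<close>
  intertwines the two operators.\<close>

lemma similar_over_iff:
  assumes A: "A \<in> sq_mats K n" and B: "B \<in> sq_mats K n"
  shows "similar_over K n A B \<longleftrightarrow> (\<exists>\<phi>. linear_iso {..<n} {..<n} \<phi> \<and>
    (\<forall>x\<in>vecs {..<n}. act n A (\<phi> x) = \<phi> (act n B x)))"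
proof
  assume "similar_over K n A B"
  then obtain P Q where P: "P \<in> sq_mats K n" and Q: "Q \<in> sq_mats K n"
    and PQ: "mult_mat_over K P Q = one_mat_over K n" and QP: "mult_mat_over K Q P = one_mat_over K n"
    and eq: "A = mult_mat_over K (mult_mat_over K P B) Q"
    by (auto simp: similar_over_def)
  have PQx: "act n P (act n Q x) = x" and QPx: "act n Q (act n P x) = x" if "x \<in> vecs {..<n}" for x
    using act_mult[OF P Q that] act_mult[OF Q P that] act_one[OF that] PQ QP by simp_all
  have "bij_betw (act n P) (vecs {..<n}) (vecs {..<n})"
    by (rule bij_betw_byWitness[where f' = "act n Q"])
      (use PQx QPx act_vecs[OF P] act_vecs[OF Q] in auto)
  then have "linear_iso {..<n} {..<n} (act n P)" using linear_map_act[OF P] by (simp add: linear_iso_def)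
  moreover have "act n A (act n P x) = act n P (act n B x)" if x: "x \<in> vecs {..<n}" for x
    unfolding eq using x act_vecs[OF P x] QPx
    by (simp add: act_mult mult_mat_over_sq P Q B)
  ultimately show "\<exists>\<phi>. linear_iso {..<n} {..<n} \<phi> \<and> (\<forall>x\<in>vecs {..<n}. act n A (\<phi> x) = \<phi> (act n B x))"
    by blast
next
  assume "\<exists>\<phi>. linear_iso {..<n} {..<n} \<phi> \<and> (\<forall>x\<in>vecs {..<n}. act n A (\<phi> x) = \<phi> (act n B x))"
  then obtain \<phi> where phi: "linear_iso {..<n} {..<n} \<phi>"
    and inter: "\<And>x. x \<in> vecs {..<n} \<Longrightarrow> act n A (\<phi> x) = \<phi> (act n B x)" by blast
  define \<psi> where "\<psi> = inv_into (vecs {..<n}) \<phi>"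
  have psi: "linear_iso {..<n} {..<n} \<psi>" unfolding \<psi>_def by (rule linear_iso_inv[OF phi])
  have lin: "linear_map {..<n} {..<n} \<phi>" "linear_map {..<n} {..<n} \<psi>"
    using phi psi by (auto simp: linear_iso_def)
  have inv: "\<phi> (\<psi> x) = x" "\<psi> (\<phi> x) = x" if "x \<in> vecs {..<n}" for x
    using phi that by (auto simp: linear_iso_def \<psi>_def bij_betw_inv_into_right bij_betw_inv_into_left)
  obtain P where P: "P \<in> sq_mats K n" "\<And>x. x \<in> vecs {..<n} \<Longrightarrow> act n P x = \<phi> x"
    using ex_act_of_linear_map[OF lin(1)] by blast
  obtain Q where Q: "Q \<in> sq_mats K n" "\<And>x. x \<in> vecs {..<n} \<Longrightarrow> act n Q x = \<psi> x"
    using ex_act_of_linear_map[OF lin(2)] by blast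
  note sq = P(1) Q(1) B mult_mat_over_sq one_mat_over_sq
  note vec = act_vecs linear_mapD(1)[OF lin(1)] linear_mapD(1)[OF lin(2)]
  have "mult_mat_over K P Q = one_mat_over K n"
    by (rule act_inject[of _ n]) (simp_all add: sq act_mult act_one P Q inv vec)
  moreover have "mult_mat_over K Q P = one_mat_over K n"
    by (rule act_inject[of _ n]) (simp_all add: sq act_mult act_one P Q inv vec)
  moreover have "A = mult_mat_over K (mult_mat_over K P B) Q"
  proof (rule act_inject[OF A])
    fix x assume x: "x \<in> vecs {..<n}"
    have "act n A x = \<phi> (act n B (\<psi> x))"
      using inter[of "\<psi> x"] inv(1)[OF x] vec(3)[OF x] by simp
    then show "act n A x = act n (mult_mat_over K (mult_mat_over K P B) Q) x"
      using x vec(3)[OF x] act_vecs[OF B vec(3)[OF x]] by (simp add: sq act_mult P(2) Q(2))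
  qed (simp add: sq)
  ultimately show "similar_over K n A B"
    unfolding similar_over_def using A B P(1) Q(1) by blast
qed

section \<open>Jordan matrices act as the shift on their diagram\<close>

lemma finsum_lessThan_shift:
  fixes k n :: nat
  assumes "\<And>q. f q \<in> carrier K" "\<And>q. q < k \<Longrightarrow> f q = \<zero>"
  shows "(\<Oplus>q\<in>{..<k + n}. f q) = (\<Oplus>q\<in>{..<n}. f (k + q))"
proof (induction n)
  case 0
  have "(\<Oplus>q\<in>{..<k}. f q) = (\<Oplus>q\<in>{..<k}. \<zero>)" using assms by (intro finsum_cong') auto
  then show ?case by simp
next
  case (Suc n)
  then show ?case using assms(1) by (simp add: lessThan_Suc Pi_def)
qed

lemma nilpotent_jordan_mat_carrier:
  "nilpotent_jordan_mat K la \<in> carrier_mat (sum_list la) (sum_list la)"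
proof (induction la)
  case (Cons k ks)
  have "nilpotent_block K k \<in> carrier_mat k k" by (simp add: nilpotent_block_def)
  then show ?case using four_block_carrier_mat[OF _ Cons] by simp
qed (simp add: zero_mat_over_def)

lemma nilpotent_jordan_mat_Cons_index:
  assumes "i < k + sum_list ks" "j < k + sum_list ks"
  shows "nilpotent_jordan_mat K (k # ks) $$ (i, j) =
    (if i < k then if j = Suc i \<and> j < k then \<one> else \<zero>
     else if j < k then \<zero> else nilpotent_jordan_mat K ks $$ (i - k, j - k))"
proof -
  have "dim_row (nilpotent_jordan_mat K ks) = sum_list ks" "dim_col (nilpotent_jordan_mat K ks) = sum_list ks"
    using nilpotent_jordan_mat_carrier[of ks] by auto
  then show ?thesis
    using assms by (auto simp: nilpotent_block_def zero_mat_over_def)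
qed

lemma nilpotent_jordan_mat_sq: "nilpotent_jordan_mat K la \<in> sq_mats K (sum_list la)"
proof (induction la)
  case (Cons k ks)
  have "nilpotent_jordan_mat K (k # ks) $$ (i, j) \<in> carrier K"
    if "i < k + sum_list ks" "j < k + sum_list ks" for i j
    using that sq_mats_carrier[OF Cons] unfolding nilpotent_jordan_mat_Cons_index[OF that] by auto
  then show ?case using nilpotent_jordan_mat_carrier[of "k # ks"]
    by (simp add: sq_mats_def del: nilpotent_jordan_mat.simps)
qed (simp add: sq_mats_def zero_mat_over_def)

lemma act_nilpotent_jordan_mat_Cons:
  assumes x: "x \<in> vecs {..<k + sum_list ks}"
  shows "act (k + sum_list ks) (nilpotent_jordan_mat K (k # ks)) x i =
    (if i < k then if Suc i < k then x (Suc i) else \<zero>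
     else act (sum_list ks) (nilpotent_jordan_mat K ks) (\<lambda>p. x (k + p)) (i - k))"
proof -
  let ?n = "k + sum_list ks" and ?J = "nilpotent_jordan_mat K (k # ks)"
  note [simp del] = nilpotent_jordan_mat.simps
  note idx = nilpotent_jordan_mat_Cons_index
  note xc [simp] = vecs_carrier[OF x]
  have J: "?J $$ (i, j) \<in> carrier K" if "i < ?n" "j < ?n" for j
    using sq_mats_carrier[OF nilpotent_jordan_mat_sq[of "k # ks"]] that by simp
  consider "Suc i < k" | "Suc i = k" | "k \<le> i" "i < ?n" | "?n \<le> i" by linarith
  then show ?thesis
  proof cases
    case 1
    have "(\<Oplus>q\<in>{..<?n}. ?J $$ (i, q) \<otimes> x q) = ?J $$ (i, Suc i) \<otimes> x (Suc i)"
      using 1 by (intro finsum_lessThan_single) (auto simp: idx intro!: m_closed J)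
    then show ?thesis using 1 by (simp add: act_def idx)
  next
    case 2
    have "(\<Oplus>q\<in>{..<?n}. ?J $$ (i, q) \<otimes> x q) = (\<Oplus>q\<in>{..<?n}. \<zero>)"
      using 2 by (intro finsum_cong') (auto simp: idx)
    then show ?thesis using 2 by (simp add: act_def)
  next
    case 3
    note J' = sq_mats_carrier[OF nilpotent_jordan_mat_sq[of ks]]
    \<comment> \<open>The summand is set to zero outside the columns of the lower block, so that it
      lies in the carrier for every index, even past the matrix.\<close>
    let ?f = "\<lambda>q. if k \<le> q \<and> q < ?n then ?J $$ (i, q) \<otimes> x q else \<zero>"
    have "(\<Oplus>q\<in>{..<?n}. ?J $$ (i, q) \<otimes> x q) = (\<Oplus>q\<in>{..<?n}. ?f q)"
      using 3 J' by (intro finsum_cong') (auto simp: idx)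
    also have "\<dots> = (\<Oplus>q\<in>{..<sum_list ks}. ?f (k + q))"
      using 3 J by (intro finsum_lessThan_shift) auto
    also have "\<dots> = (\<Oplus>q\<in>{..<sum_list ks}. nilpotent_jordan_mat K ks $$ (i - k, q) \<otimes> x (k + q))"
      using 3 J'
      by (intro finsum_cong') (auto simp: idx)
    finally show ?thesis using 3 by (simp add: act_def)
  next
    case 4 then show ?thesis by (simp add: act_def)
  qed
qed

text \<open>Each block supplies one row of the diagram: the first block takes row 0, and the other
  rows come from the induction hypothesis.\<close>

lemma has_jordan_type_nilpotent_jordan_mat:
  "has_jordan_type (sum_list la) (act (sum_list la) (nilpotent_jordan_mat K la)) (row_len la)"
proof (induction la)
  case Nil
  have "cells (row_len []) = {}" by (simp add: cells_row_len)
  then show ?case using has_jordan_type_0 by simp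
next
  case (Cons k ks)
  let ?n = "sum_list ks"
  obtain \<phi> where phi: "linear_iso (cells (row_len ks)) {..<?n} \<phi>"
    "\<And>z. z \<in> vecs (cells (row_len ks)) \<Longrightarrow> act ?n (nilpotent_jordan_mat K ks) (\<phi> z) = \<phi> (shift z)"
    using Cons by (auto simp: has_jordan_type_def)
  have lin: "linear_map (cells (row_len ks)) {..<?n} \<phi>" using phi by (simp add: linear_iso_def)
  \<comment> \<open>\<open>t\<close> removes row 0; \<open>g\<close> puts that row into the first
    \<open>k\<close> coordinates and the image of the rest behind it.\<close>
  define t where "t z = (\<lambda>(i, j). z (Suc i, j))" for z :: "nat \<times> nat \<Rightarrow> 'a"
  define g where "g z p = (if p < k then z (0, p) else \<phi> (t z) (p - k))" for z p
  let ?V = "vecs (cells (row_len (k # ks)))"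
  have t: "t z \<in> vecs (cells (row_len ks))" if "z \<in> ?V" for z
    using that by (auto simp: t_def vecs_def)
  have t_shift: "t (shift z) = shift (t z)" for z by (auto simp: t_def fun_eq_iff)
  have gv: "g z \<in> vecs {..<k + ?n}" if z: "z \<in> ?V" for z
  proof (rule vecsI)
    note y = linear_mapD(1)[OF lin t[OF z]]
    show "g z p \<in> carrier K" for p using vecs_carrier[OF z] vecs_carrier[OF y] by (simp add: g_def)
    show "g z p = \<zero>" if "p \<notin> {..<k + ?n}" for p
      using that vecs_outside[OF y] by (auto simp: g_def)
  qed
  have "linear_map (cells (row_len (k # ks))) {..<k + ?n} g"
  proof (rule linear_mapI)
    show "g (vadd x y) p = g x p \<oplus> g y p" if "x \<in> ?V" "y \<in> ?V" for x y p
    proof -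
      have "t (vadd x y) = vadd (t x) (t y)" by (auto simp: t_def vadd_def)
      then show ?thesis
        using linear_mapD(2)[OF lin t t] that by (simp add: g_def) (simp add: vadd_def)
    qed
    show "g (vscale a x) p = a \<otimes> g x p" if "a \<in> carrier K" "x \<in> ?V" for a x p
    proof -
      have "t (vscale a x) = vscale a (t x)" by (auto simp: t_def vscale_def)
      then show ?thesis
        using linear_mapD(3)[OF lin t] that by (simp add: g_def) (simp add: vscale_def)
    qed
  qed (rule gv)
  then have "linear_iso (cells (row_len (k # ks))) {..<k + ?n} g"
  proof (rule linear_iso_of_kernel)
    show "finite (cells (row_len (k # ks)))" by (rule finite_cells_row_len)
    show "card (cells (row_len (k # ks))) = card {..<k + ?n}" by (simp add: card_cells_row_len)
    fix z assume z: "z \<in> ?V" and g0: "g z = vzero"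
    have z0: "z (0, p) = \<zero>" for p
      using fun_cong[OF g0, of p] vecs_outside[OF z, of "(0, p)"] by (cases "p < k") (auto simp: g_def)
    have "\<phi> (t z) p = \<zero>" for p using fun_cong[OF g0, of "p + k"] by (simp add: g_def)
    then have "\<phi> (t z) = \<phi> vzero" using linear_map_zero[OF lin] by auto
    then have "t z = vzero" using phi(1) t[OF z] by (auto simp: linear_iso_def bij_betw_def dest: inj_onD)
    then have "t z (i, j) = \<zero>" for i j by simp
    then have "z (Suc i, j) = \<zero>" for i j by (simp add: t_def)
    then have "z (i, j) = \<zero>" for i j using z0 by (cases i) auto
    then show "z = vzero" by auto
  qed simp
  moreover have "act (k + ?n) (nilpotent_jordan_mat K (k # ks)) (g z) = g (shift z)" if z: "z \<in> ?V" for z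
  proof
    fix p
    have "(\<lambda>q. g z (k + q)) = \<phi> (t z)" by (simp add: g_def)
    moreover have "z (0, Suc p) = \<zero>" if "\<not> Suc p < k" using vecs_outside[OF z, of "(0, Suc p)"] that by simp
    ultimately show "act (k + ?n) (nilpotent_jordan_mat K (k # ks)) (g z) p = g (shift z) p"
      unfolding act_nilpotent_jordan_mat_Cons[OF gv[OF z]]
      using phi(2)[OF t[OF z]] by (auto simp: g_def t_shift)
  qed
  ultimately show ?case unfolding has_jordan_type_def by (auto simp del: nilpotent_jordan_mat.simps)
qed

text \<open>The Jordan matrix has coordinates \<open>\<theta>\<close> of type
  \<open>row_len la\<close>. Composing with \<open>\<theta>\<close> or its inverse exchanges
  intertwining automorphisms and Jordan coordinates of \<open>A\<close>.\<close>

lemma similar_jordan_iff: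
  assumes "A \<in> sq_mats K (sum_list la)"
  shows "similar_over K (sum_list la) A (nilpotent_jordan_mat K la)
    \<longleftrightarrow> has_jordan_type (sum_list la) (act (sum_list la) A) (row_len la)"
proof -
  define n where "n = sum_list la"
  define J where "J = nilpotent_jordan_mat K la"
  define C where "C = cells (row_len la)"
  obtain \<theta> where theta: "linear_iso C {..<n} \<theta>"
    "\<And>z. z \<in> vecs C \<Longrightarrow> act n J (\<theta> z) = \<theta> (shift z)"
    using has_jordan_type_nilpotent_jordan_mat[of la] by (auto simp: has_jordan_type_def n_def J_def C_def)
  have J: "J \<in> sq_mats K n" unfolding J_def n_def by (rule nilpotent_jordan_mat_sq)
  have thv: "\<theta> z \<in> vecs {..<n}" if "z \<in> vecs C" for z
    using theta(1) that by (auto simp: linear_iso_def linear_map_def)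
  have "(\<exists>\<phi>. linear_iso {..<n} {..<n} \<phi> \<and> (\<forall>x\<in>vecs {..<n}. act n A (\<phi> x) = \<phi> (act n J x)))
    \<longleftrightarrow> has_jordan_type n (act n A) (row_len la)"
  proof
    assume "\<exists>\<phi>. linear_iso {..<n} {..<n} \<phi> \<and> (\<forall>x\<in>vecs {..<n}. act n A (\<phi> x) = \<phi> (act n J x))"
    then obtain \<phi> where phi: "linear_iso {..<n} {..<n} \<phi>"
      "\<And>x. x \<in> vecs {..<n} \<Longrightarrow> act n A (\<phi> x) = \<phi> (act n J x)" by blast
    have "linear_iso C {..<n} (\<lambda>z. \<phi> (\<theta> z))" by (rule linear_iso_comp[OF theta(1) phi(1)])
    moreover have "act n A (\<phi> (\<theta> z)) = \<phi> (\<theta> (shift z))" if "z \<in> vecs C" for z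
      using phi(2)[OF thv[OF that]] theta(2)[OF that] by simp
    ultimately show "has_jordan_type n (act n A) (row_len la)"
      unfolding has_jordan_type_def C_def by blast
  next
    assume "has_jordan_type n (act n A) (row_len la)"
    then obtain \<phi> where phi: "linear_iso C {..<n} \<phi>"
      "\<And>z. z \<in> vecs C \<Longrightarrow> act n A (\<phi> z) = \<phi> (shift z)"
      by (auto simp: has_jordan_type_def C_def)
    let ?i = "inv_into (vecs C) \<theta>"
    have inv: "linear_iso {..<n} C ?i" by (rule linear_iso_inv[OF theta(1)])
    have "linear_iso {..<n} {..<n} (\<lambda>x. \<phi> (?i x))" by (rule linear_iso_comp[OF inv phi(1)])
    moreover have "act n A (\<phi> (?i x)) = \<phi> (?i (act n J x))" if x: "x \<in> vecs {..<n}" for x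
    proof -
      have ix: "?i x \<in> vecs C" using inv x by (auto simp: linear_iso_def linear_map_def)
      have "\<theta> (?i x) = x"
        using bij_betw_inv_into_right[of \<theta> "vecs C" "vecs {..<n}" x] theta(1) x
        by (simp add: linear_iso_def)
      then have "act n J x = \<theta> (shift (?i x))" using theta(2)[OF ix] by simp
      moreover have "shift (?i x) \<in> vecs C" using ix by (simp add: C_def)
      ultimately have "?i (act n J x) = shift (?i x)"
        using bij_betw_inv_into_left[of \<theta> "vecs C" "vecs {..<n}" "shift (?i x)"] theta(1)
        by (simp add: linear_iso_def)
      then show ?thesis using phi(2)[OF ix] by simp
    qed
    ultimately show "\<exists>\<phi>. linear_iso {..<n} {..<n} \<phi> \<and> (\<forall>x\<in>vecs {..<n}. act n A (\<phi> x) = \<phi> (act n J x))"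
      by blast
  qed
  then show ?thesis using similar_over_iff[OF _ J, of A] assms by (simp add: n_def J_def)
qed

lemma jordan_type_count_eq_poly:
  assumes "partition_of la n"
  shows "int (jordan_type_count K la) = poly (jpoly n (row_len la)) (int (card (carrier K)))"
proof -
  have n: "sum_list la = n" using assms by (simp add: partition_of_def)
  have "jordan_type_count K la = card (jordan_mats n (row_len la))"
    unfolding jordan_type_count_def jordan_mats_def n[symmetric]
    by (intro arg_cong[where f = card]) (auto simp: similar_jordan_iff strictly_upper_sq)
  then show ?thesis using card_jordan_mats[OF is_partition_row_len[OF assms]] by simp
qed

end

section \<open>The counting polynomial\<close>

text \<open>A nonzero polynomial has finitely many roots, but there are infinitely many
  primes.\<close>

lemma poly_eqI_primes:
  fixes f g :: "int poly"
  assumes "\<And>p :: nat. prime p \<Longrightarrow> poly f (int p) = poly g (int p)"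
  shows "f = g"
proof (rule ccontr)
  assume "f \<noteq> g"
  then have "finite {x. poly (f - g) x = 0}" by (intro poly_roots_finite) simp
  moreover have "int ` {p. prime p} \<subseteq> {x. poly (f - g) x = 0}" using assms by auto
  ultimately have "finite (int ` {p :: nat. prime p})" by (rule rev_finite_subset)
  then show False using primes_infinite by (simp add: finite_image_iff)
qed

text \<open>\<open>jpoly\<close> has the required values over all finite fields, and its values at
  the prime fields already fix it.\<close>

lemma jordan_type_poly_eq:
  assumes "partition_of la n"
  shows "jordan_type_poly la = jpoly n (row_len la)"
  unfolding jordan_type_poly_def
proof (rule the_equality)
  show "\<forall>K :: int ring. field K \<longrightarrow> finite (carrier K) \<longrightarrow>
    poly (jpoly n (row_len la)) (int (card (carrier K))) = int (jordan_type_count K la)"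
  proof (intro allI impI)
    fix K :: "int ring" assume "field K" "finite (carrier K)"
    then interpret fin_field K by (simp add: fin_field_def fin_field_axioms_def)
    show "poly (jpoly n (row_len la)) (int (card (carrier K))) = int (jordan_type_count K la)"
      using jordan_type_count_eq_poly[OF assms] by simp
  qed
next
  fix F :: "int poly"
  assume F: "\<forall>K :: int ring. field K \<longrightarrow> finite (carrier K) \<longrightarrow>
    poly F (int (card (carrier K))) = int (jordan_type_count K la)"
  show "F = jpoly n (row_len la)"
  proof (rule poly_eqI_primes)
    fix p :: nat assume "prime p"
    \<comment> \<open>The residue ring modulo \<open>p\<close> is a field record on
      \<open>int\<close> with \<open>p\<close> elements, hence one of those quantified over in the
      definition.\<close>
    then interpret R: residues_prime p "residue_ring (int p)" by unfold_locales
    interpret fin_field "residue_ring (int p)" by unfold_locales simp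
    have "card (carrier (residue_ring (int p))) = p" by (simp add: R.res_carrier_eq)
    then show "poly F (int p) = poly (jpoly n (row_len la)) (int p)"
      using F[rule_format, OF R.is_field] jordan_type_count_eq_poly[OF assms] finite_carrier by simp
  qed
qed

theorem corollary2p10:
  fixes la :: "nat list" and n :: nat
  assumes "partition_of la n"
  shows "int (degree (jordan_type_poly la)) = int (n choose 2) - int (partition_n la)
    \<and> lead_coeff (jordan_type_poly la) = int (card (standard_tableaux la))"
proof -
  define d where "d = (n choose 2) - row_weight (row_len la)"
  have part: "is_partition n (row_len la)" by (rule is_partition_row_len[OF assms])
  have top: "row_weight (row_len la) \<le> n choose 2" "degree (jpoly n (row_len la)) \<le> d"
    "Polynomial.coeff (jpoly n (row_len la)) d = int (card (syt (row_len la)))"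
    using jpoly_top[OF part] by (auto simp: d_def)
  \<comment> \<open>The coefficient at the degree bound counts tableaux and is positive, so the
    bound is attained.\<close>
  have "Polynomial.coeff (jpoly n (row_len la)) d \<noteq> 0" using top(3) card_syt_pos[OF part] by simp
  then have "degree (jpoly n (row_len la)) = d" using top(2) le_degree le_antisym by blast
  then show ?thesis
    using top by (simp add: jordan_type_poly_eq[OF assms] standard_tableaux_eq_syt d_def
      flip: row_weight_row_len)
qed

end
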